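(* Let $\omega$ be a self-orthogonal subcategory of $\mathfrak{C}$ and let $M\in\mathfrak{C}$. The following statements are equivalent. (1) $M\in\widetilde{\omega}$ (resp. $M\in\check{{}_{\omega}\mathscr{X}}$). (2) There is an $\mathbb{E}$-triangle $U\to V\to M\dashrightarrow$ with $U\in\hat{\omega}$ (resp. $U\in{}_{\omega}\mathscr{X}$) and $V\in\check{\omega}$. (3) There is an $\mathbb{E}$-triangle $M\to U'\to V'\dashrightarrow$ with $U'\in\hat{\omega}$ (resp. $U'\in{}_{\omega}\mathscr{X}$) and $V'\in\check{\omega}$.
   Context: Standing assumptions: $(\mathfrak{C},\mathbb{E},\mathfrak{s})$ is a Krull-Schmidt extriangulated category (in the sense of Nakaoka-Palu) with enough projectives and enough injectives. "Subcategory" means full additive subcategory closed under isomorphisms and direct summands. $A\to B\to C\dashrightarrow$ is an $\mathbb{E}$-triangle if it realizes some element of $\mathbb{E}(C,A)$. Higher extensions are $\mathbb{E}^{i+1}(X,Y)\cong\mathbb{E}(X,\Sigma^{i}Y)\cong\mathbb{E}(\Omega^{i}X,Y)$ for $i\ge 0$, where $\Omega$, $\Sigma$ denote syzygy and cosyzygy. An $\mathbb{E}$-triangle sequence is a sequence of morphisms obtained by splicing $\mathbb{E}$-triangles $K_{i+1}\to W_i\to K_i\dashrightarrow$ (a finite sequence begins with the cocone term of the first spliced $\mathbb{E}$-triangle and ends with the cone term of the last). For a class $\omega$ of objects: $\omega^{\bot}=\{Y\mid \mathbb{E}^{i}(X,Y)=0\ \forall i\ge1,\ \forall X\in\omega\}$;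 $\omega$ is self-orthogonal if $\omega\subseteq\omega^{\bot}$. $\hat{\omega}$ (resp. $\check\omega$) is the class of $A$ admitting, for some $n\ge0$, an $\mathbb{E}$-triangle sequence $W_n\to\cdots\to W_0\to A$ (resp. $A\to W^0\to\cdots\to W^n$) with all terms other than $A$ in $\omega$; $\widetilde{\omega}=\check{\hat{\omega}}$, i.e. the operation $\check{(\ )}$ applied to $\hat\omega$; similarly $\check{{}_{\omega}\mathscr{X}}$ is $\check{(\ )}$ applied to ${}_{\omega}\mathscr{X}$. For $\omega$ self-orthogonal, ${}_{\omega}\mathscr{X}$ is the class of $A$ admitting an $\mathbb{E}$-triangle sequence $\cdots\to W_1\to W_0\to A$, spliced from $\mathbb{E}$-triangles $K_{i+1}\to W_i\to K_i\dashrightarrow$ ($i\ge 0$, $K_0=A$), with all $W_i\in\omega$ and all $K_i\in\omega^{\bot}$. *)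

theory Defs
  imports "HOL-Algebra.Ring"
begin

section \<open>Additive categories\<close>

(* Mor A B is the abelian group of morphisms from A to B.  Abelian groups are rendered by
   HOL-Algebra's comm_group, hence written multiplicatively: the sum of f and g in Mor A B is
   f \<otimes>\<^bsub>Mor A B\<^esub> g and the zero morphism is \<one>\<^bsub>Mor A B\<^esub>.
   Composition is in the applicative order: g \<cdot> f is "first f, then g". *)
record ('o, 'm) cat =
  obj :: "'o set" ("Ob\<index>")
  mor :: "'o \<Rightarrow> 'o \<Rightarrow> 'm monoid" ("Mor\<index>")
  idt :: "'o \<Rightarrow> 'm" ("Idt\<index>")
  cmp :: "'m \<Rightarrow> 'm \<Rightarrow> 'm" (infixl "\<cdot>\<index>" 70)

context
  fixes \<C> :: "('o, 'm, 'z) cat_scheme" (structure)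
begin

definition is_iso :: "'o \<Rightarrow> 'o \<Rightarrow> 'm \<Rightarrow> bool" where
  "is_iso A B f \<longleftrightarrow> f \<in> carrier (Mor A B) \<and>
     (\<exists>g \<in> carrier (Mor B A). g \<cdot> f = Idt A \<and> f \<cdot> g = Idt B)"

definition isomorphic :: "'o \<Rightarrow> 'o \<Rightarrow> bool" where
  "isomorphic A B \<longleftrightarrow> (\<exists>f. is_iso A B f)"

definition is_zero_object :: "'o \<Rightarrow> bool" where
  "is_zero_object Z \<longleftrightarrow> Z \<in> Ob \<and> Idt Z = \<one>\<^bsub>Mor Z Z\<^esub>"

definition is_biproduct :: "'o \<Rightarrow> 'o \<Rightarrow> 'o \<Rightarrow> 'm \<Rightarrow> 'm \<Rightarrow> 'm \<Rightarrow> 'm \<Rightarrow> bool" where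
  "is_biproduct S A B i j p q \<longleftrightarrow>
     S \<in> Ob \<and> A \<in> Ob \<and> B \<in> Ob \<and>
     i \<in> carrier (Mor A S) \<and> j \<in> carrier (Mor B S) \<and>
     p \<in> carrier (Mor S A) \<and> q \<in> carrier (Mor S B) \<and>
     p \<cdot> i = Idt A \<and> q \<cdot> j = Idt B \<and>
     p \<cdot> j = \<one>\<^bsub>Mor B A\<^esub> \<and> q \<cdot> i = \<one>\<^bsub>Mor A B\<^esub> \<and>
     (i \<cdot> p) \<otimes>\<^bsub>Mor S S\<^esub> (j \<cdot> q) = Idt S"

definition is_finite_direct_sum :: "'o \<Rightarrow> nat \<Rightarrow> (nat \<Rightarrow> 'o) \<Rightarrow> bool" where
  "is_finite_direct_sum S n X \<longleftrightarrow>
     S \<in> Ob \<and> (\<forall>k<n. X k \<in> Ob) \<and>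
     (\<exists>i p. (\<forall>k<n. i k \<in> carrier (Mor (X k) S) \<and> p k \<in> carrier (Mor S (X k))) \<and>
            (\<forall>k<n. \<forall>l<n. p l \<cdot> i k = (if k = l then Idt (X k) else \<one>\<^bsub>Mor (X k) (X l)\<^esub>)) \<and>
            finprod (Mor S S) (\<lambda>k. i k \<cdot> p k) {..<n} = Idt S)"

definition end_ring :: "'o \<Rightarrow> 'm ring" where
  "end_ring A = \<lparr>carrier = carrier (Mor A A), mult = (\<lambda>f g. f \<cdot> g), one = Idt A,
                 zero = \<one>\<^bsub>Mor A A\<^esub>, add = (\<lambda>f g. f \<otimes>\<^bsub>Mor A A\<^esub> g)\<rparr>"

end

(* The rings are not assumed commutative: local means that the non-units form a proper subset
   closed under addition. *)
definition local_ring :: "('a, 'b) ring_scheme \<Rightarrow> bool" where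
  "local_ring R \<longleftrightarrow> ring R \<and> \<one>\<^bsub>R\<^esub> \<noteq> \<zero>\<^bsub>R\<^esub> \<and>
     (\<forall>a \<in> carrier R - Units R. \<forall>b \<in> carrier R - Units R. a \<oplus>\<^bsub>R\<^esub> b \<notin> Units R)"

definition krull_schmidt :: "('o, 'm, 'z) cat_scheme \<Rightarrow> bool" where
  "krull_schmidt \<C> \<longleftrightarrow>
     (\<forall>A \<in> Ob\<^bsub>\<C>\<^esub>. \<exists>n X. is_finite_direct_sum \<C> A n X \<and> (\<forall>k<n. local_ring (end_ring \<C> (X k))))"

locale additive_category =
  fixes \<C> :: "('o, 'm, 'z) cat_scheme" (structure)
  assumes Idt_closed: "A \<in> Ob \<Longrightarrow> Idt A \<in> carrier (Mor A A)"
    and Cmp_closed: "\<lbrakk>A \<in> Ob; B \<in> Ob; D \<in> Ob; f \<in> carrier (Mor A B); g \<in> carrier (Mor B D)\<rbrakk>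
          \<Longrightarrow> g \<cdot> f \<in> carrier (Mor A D)"
    and Cmp_assoc: "\<lbrakk>A \<in> Ob; B \<in> Ob; D \<in> Ob; F \<in> Ob;
            f \<in> carrier (Mor A B); g \<in> carrier (Mor B D); h \<in> carrier (Mor D F)\<rbrakk>
          \<Longrightarrow> h \<cdot> (g \<cdot> f) = (h \<cdot> g) \<cdot> f"
    and Idt_left: "\<lbrakk>A \<in> Ob; B \<in> Ob; f \<in> carrier (Mor A B)\<rbrakk> \<Longrightarrow> Idt B \<cdot> f = f"
    and Idt_right: "\<lbrakk>A \<in> Ob; B \<in> Ob; f \<in> carrier (Mor A B)\<rbrakk> \<Longrightarrow> f \<cdot> Idt A = f"
    and Mor_disjoint: "\<lbrakk>A \<in> Ob; B \<in> Ob; A' \<in> Ob; B' \<in> Ob;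
            f \<in> carrier (Mor A B); f \<in> carrier (Mor A' B')\<rbrakk> \<Longrightarrow> A = A' \<and> B = B'"
    and Mor_group: "\<lbrakk>A \<in> Ob; B \<in> Ob\<rbrakk> \<Longrightarrow> comm_group (Mor A B)"
    and Cmp_hom_right: "\<lbrakk>A \<in> Ob; B \<in> Ob; D \<in> Ob; g \<in> carrier (Mor B D)\<rbrakk>
          \<Longrightarrow> (\<lambda>f. g \<cdot> f) \<in> hom (Mor A B) (Mor A D)"
    and Cmp_hom_left: "\<lbrakk>A \<in> Ob; B \<in> Ob; D \<in> Ob; f \<in> carrier (Mor A B)\<rbrakk>
          \<Longrightarrow> (\<lambda>g. g \<cdot> f) \<in> hom (Mor B D) (Mor A D)"
    and zero_object_exists: "\<exists>Z. is_zero_object \<C> Z"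
    and biproduct_exists: "\<lbrakk>A \<in> Ob; B \<in> Ob\<rbrakk> \<Longrightarrow> \<exists>S i j p q. is_biproduct \<C> S A B i j p q"


section \<open>Extriangulated categories (Nakaoka--Palu)\<close>

(* Ext C A is the abelian group E(C,A), and ExtMap c a is the map E(c,a): E(C,A) \<rightarrow> E(C',A') for
   c: C' \<rightarrow> C and a: A \<rightarrow> A'.  Rlz C A \<delta> is the equivalence class s(\<delta>) of sequences
   A \<rightarrow> B \<rightarrow> C, a sequence being stored as (x, B, y) with x: A \<rightarrow> B and y: B \<rightarrow> C. *)
record ('o, 'm, 'e) extcat = "('o, 'm) cat" +
  ext_group :: "'o \<Rightarrow> 'o \<Rightarrow> 'e monoid" ("Ext\<index>")
  ext_map :: "'m \<Rightarrow> 'm \<Rightarrow> 'e \<Rightarrow> 'e" ("ExtMap\<index>")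
  rlz :: "'o \<Rightarrow> 'o \<Rightarrow> 'e \<Rightarrow> ('m \<times> 'o \<times> 'm) set" ("Rlz\<index>")

context
  fixes \<C> :: "('o, 'm, 'e, 'z) extcat_scheme" (structure)
begin

definition push :: "'o \<Rightarrow> 'm \<Rightarrow> 'e \<Rightarrow> 'e" where
  "push C a \<delta> = ExtMap (Idt C) a \<delta>"

definition pull :: "'o \<Rightarrow> 'm \<Rightarrow> 'e \<Rightarrow> 'e" where
  "pull A c \<delta> = ExtMap c (Idt A) \<delta>"

definition is_seq :: "'o \<Rightarrow> 'm \<Rightarrow> 'o \<Rightarrow> 'm \<Rightarrow> 'o \<Rightarrow> bool" where
  "is_seq A x B y C \<longleftrightarrow> A \<in> Ob \<and> B \<in> Ob \<and> C \<in> Ob \<and>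
     x \<in> carrier (Mor A B) \<and> y \<in> carrier (Mor B C)"

definition seq_class :: "'o \<Rightarrow> 'm \<Rightarrow> 'o \<Rightarrow> 'm \<Rightarrow> 'o \<Rightarrow> ('m \<times> 'o \<times> 'm) set" where
  "seq_class A x B y C =
     {(x', B', y'). is_seq A x' B' y' C \<and> (\<exists>b. is_iso \<C> B B' b \<and> b \<cdot> x = x' \<and> y' \<cdot> b = y)}"

definition realizes :: "'o \<Rightarrow> 'm \<Rightarrow> 'o \<Rightarrow> 'm \<Rightarrow> 'o \<Rightarrow> 'e \<Rightarrow> bool" where
  "realizes A x B y C \<delta> \<longleftrightarrow>
     is_seq A x B y C \<and> \<delta> \<in> carrier (Ext C A) \<and> Rlz C A \<delta> = seq_class A x B y C"

end

(* In realizes_sum, P, Q and S are direct sums of A and A', of C and C' and of B and B'; the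
   element ExtMap p i \<delta> + ExtMap q j \<delta>' of E(Q,P) is \<delta> \<oplus> \<delta>', i.e. it corresponds to
   (\<delta>, 0, 0, \<delta>') under the decomposition of E(C \<oplus> C', A \<oplus> A') into four summands. *)
locale extriangulated_category = additive_category \<C>
  for \<C> :: "('o, 'm, 'e, 'z) extcat_scheme" (structure) +
  assumes Ext_group: "\<lbrakk>C \<in> Ob; A \<in> Ob\<rbrakk> \<Longrightarrow> comm_group (Ext C A)"
    and ExtMap_hom: "\<lbrakk>C \<in> Ob; C' \<in> Ob; A \<in> Ob; A' \<in> Ob;
            c \<in> carrier (Mor C' C); a \<in> carrier (Mor A A')\<rbrakk>
          \<Longrightarrow> ExtMap c a \<in> hom (Ext C A) (Ext C' A')"
    and ExtMap_Idt: "\<lbrakk>C \<in> Ob; A \<in> Ob; \<delta> \<in> carrier (Ext C A)\<rbrakk>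
          \<Longrightarrow> ExtMap (Idt C) (Idt A) \<delta> = \<delta>"
    and ExtMap_Cmp: "\<lbrakk>C \<in> Ob; C' \<in> Ob; C'' \<in> Ob; A \<in> Ob; A' \<in> Ob; A'' \<in> Ob;
            c \<in> carrier (Mor C' C); c' \<in> carrier (Mor C'' C');
            a \<in> carrier (Mor A A'); a' \<in> carrier (Mor A' A''); \<delta> \<in> carrier (Ext C A)\<rbrakk>
          \<Longrightarrow> ExtMap (c \<cdot> c') (a' \<cdot> a) \<delta> = ExtMap c' a' (ExtMap c a \<delta>)"
    and ExtMap_add_left: "\<lbrakk>C \<in> Ob; C' \<in> Ob; A \<in> Ob; A' \<in> Ob;
            c \<in> carrier (Mor C' C); c' \<in> carrier (Mor C' C); a \<in> carrier (Mor A A');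
            \<delta> \<in> carrier (Ext C A)\<rbrakk>
          \<Longrightarrow> ExtMap (c \<otimes>\<^bsub>Mor C' C\<^esub> c') a \<delta> = ExtMap c a \<delta> \<otimes>\<^bsub>Ext C' A'\<^esub> ExtMap c' a \<delta>"
    and ExtMap_add_right: "\<lbrakk>C \<in> Ob; C' \<in> Ob; A \<in> Ob; A' \<in> Ob;
            c \<in> carrier (Mor C' C); a \<in> carrier (Mor A A'); a' \<in> carrier (Mor A A');
            \<delta> \<in> carrier (Ext C A)\<rbrakk>
          \<Longrightarrow> ExtMap c (a \<otimes>\<^bsub>Mor A A'\<^esub> a') \<delta> = ExtMap c a \<delta> \<otimes>\<^bsub>Ext C' A'\<^esub> ExtMap c a' \<delta>"
    and realization: "\<lbrakk>C \<in> Ob; A \<in> Ob; \<delta> \<in> carrier (Ext C A)\<rbrakk>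
          \<Longrightarrow> \<exists>x B y. realizes \<C> A x B y C \<delta>"
    and realization_mor: "\<lbrakk>realizes \<C> A x B y C \<delta>; realizes \<C> A' x' B' y' C' \<delta>';
            a \<in> carrier (Mor A A'); c \<in> carrier (Mor C C'); push \<C> C a \<delta> = pull \<C> A' c \<delta>'\<rbrakk>
          \<Longrightarrow> \<exists>b \<in> carrier (Mor B B'). b \<cdot> x = x' \<cdot> a \<and> y' \<cdot> b = c \<cdot> y"
    and realizes_zero: "is_biproduct \<C> S A C i j p q \<Longrightarrow> realizes \<C> A i S q C \<one>\<^bsub>Ext C A\<^esub>"
    and realizes_sum: "\<lbrakk>realizes \<C> A x B y C \<delta>; realizes \<C> A' x' B' y' C' \<delta>';
            is_biproduct \<C> P A A' iA jA pA qA; is_biproduct \<C> S B B' iB jB pB qB;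
            is_biproduct \<C> Q C C' iC jC pC qC\<rbrakk>
          \<Longrightarrow> realizes \<C> P ((iB \<cdot> x \<cdot> pA) \<otimes>\<^bsub>Mor P S\<^esub> (jB \<cdot> x' \<cdot> qA))
                        S ((iC \<cdot> y \<cdot> pB) \<otimes>\<^bsub>Mor S Q\<^esub> (jC \<cdot> y' \<cdot> qB)) Q
                        (ExtMap pC iA \<delta> \<otimes>\<^bsub>Ext Q P\<^esub> ExtMap qC jA \<delta>')"
    and ET3: "\<lbrakk>realizes \<C> A x B y C \<delta>; realizes \<C> A' x' B' y' C' \<delta>';
            a \<in> carrier (Mor A A'); b \<in> carrier (Mor B B'); b \<cdot> x = x' \<cdot> a\<rbrakk>
          \<Longrightarrow> \<exists>c \<in> carrier (Mor C C'). c \<cdot> y = y' \<cdot> b \<and> push \<C> C a \<delta> = pull \<C> A' c \<delta>'"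
    and ET3op: "\<lbrakk>realizes \<C> A x B y C \<delta>; realizes \<C> A' x' B' y' C' \<delta>';
            b \<in> carrier (Mor B B'); c \<in> carrier (Mor C C'); c \<cdot> y = y' \<cdot> b\<rbrakk>
          \<Longrightarrow> \<exists>a \<in> carrier (Mor A A'). b \<cdot> x = x' \<cdot> a \<and> push \<C> C a \<delta> = pull \<C> A' c \<delta>'"
    and ET4: "\<lbrakk>realizes \<C> A f B f' D \<delta>; realizes \<C> B g C g' F \<delta>'\<rbrakk>
          \<Longrightarrow> \<exists>E h h' d e \<delta>''.
                realizes \<C> A h C h' E \<delta>'' \<and> realizes \<C> D d E e F (push \<C> F f' \<delta>') \<and>
                h = g \<cdot> f \<and> h' \<cdot> g = d \<cdot> f' \<and> e \<cdot> h' = g' \<and>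
                pull \<C> A d \<delta>'' = \<delta> \<and> push \<C> E f \<delta>'' = pull \<C> B e \<delta>'"
    and ET4op: "\<lbrakk>realizes \<C> D f' A f B \<delta>; realizes \<C> F g' B g C \<delta>'\<rbrakk>
          \<Longrightarrow> \<exists>E h h' d e \<delta>''.
                realizes \<C> E h' A h C \<delta>'' \<and> realizes \<C> D d E e F (pull \<C> D g' \<delta>) \<and>
                h = g \<cdot> f \<and> h' \<cdot> d = f' \<and> f \<cdot> h' = g' \<cdot> e \<and>
                push \<C> C e \<delta>'' = \<delta>' \<and> push \<C> B d \<delta> = pull \<C> E g \<delta>''"

context
  fixes \<C> :: "('o, 'm, 'e, 'z) extcat_scheme" (structure)
begin

definition etriangle :: "'o \<Rightarrow> 'm \<Rightarrow> 'o \<Rightarrow> 'm \<Rightarrow> 'o \<Rightarrow> bool" where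
  "etriangle A x B y C \<longleftrightarrow> (\<exists>\<delta>. realizes \<C> A x B y C \<delta>)"

definition has_etriangle :: "'o \<Rightarrow> 'o \<Rightarrow> 'o \<Rightarrow> bool" where
  "has_etriangle A B C \<longleftrightarrow> (\<exists>x y. etriangle A x B y C)"

definition projective :: "'o \<Rightarrow> bool" where
  "projective P \<longleftrightarrow> P \<in> Ob \<and>
     (\<forall>A x B y C. etriangle A x B y C \<longrightarrow>
        (\<forall>c \<in> carrier (Mor P C). \<exists>b \<in> carrier (Mor P B). y \<cdot> b = c))"

definition injective :: "'o \<Rightarrow> bool" where
  "injective I \<longleftrightarrow> I \<in> Ob \<and>
     (\<forall>A x B y C. etriangle A x B y C \<longrightarrow>
        (\<forall>a \<in> carrier (Mor A I). \<exists>b \<in> carrier (Mor B I). b \<cdot> x = a))"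

definition enough_projectives :: bool where
  "enough_projectives \<longleftrightarrow> (\<forall>C \<in> Ob. \<exists>K P. projective P \<and> has_etriangle K P C)"

definition enough_injectives :: bool where
  "enough_injectives \<longleftrightarrow> (\<forall>A \<in> Ob. \<exists>I K. injective I \<and> has_etriangle A I K)"

definition syzygy :: "'o \<Rightarrow> 'o" where
  "syzygy X = (SOME K. \<exists>P. projective P \<and> has_etriangle K P X)"

(* For i \<ge> 1 this is the group of i-th extensions, via E(\<Omega>^(i-1) X, Y); i = 0 is meaningless.
   It does not depend, up to isomorphism, on the syzygies chosen. *)
definition higher_ext :: "nat \<Rightarrow> 'o \<Rightarrow> 'o \<Rightarrow> 'e monoid" where
  "higher_ext i X Y = Ext ((syzygy ^^ (i - 1)) X) Y"

definition subcategory :: "'o set \<Rightarrow> bool" where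
  "subcategory \<omega> \<longleftrightarrow> \<omega> \<subseteq> Ob \<and>
     (\<exists>Z \<in> \<omega>. is_zero_object \<C> Z) \<and>
     (\<forall>S A B i j p q. is_biproduct \<C> S A B i j p q \<longrightarrow> A \<in> \<omega> \<longrightarrow> B \<in> \<omega> \<longrightarrow> S \<in> \<omega>) \<and>
     (\<forall>A \<in> \<omega>. \<forall>B \<in> Ob. isomorphic \<C> A B \<longrightarrow> B \<in> \<omega>) \<and>
     (\<forall>S A B i j p q. is_biproduct \<C> S A B i j p q \<longrightarrow> S \<in> \<omega> \<longrightarrow> A \<in> \<omega> \<and> B \<in> \<omega>)"

definition right_perp :: "'o set \<Rightarrow> 'o set" where
  "right_perp \<omega> =
     {Y \<in> Ob. \<forall>i\<ge>1. \<forall>X \<in> \<omega>. carrier (higher_ext i X Y) = {\<one>\<^bsub>higher_ext i X Y\<^esub>}}"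

definition self_orthogonal :: "'o set \<Rightarrow> bool" where
  "self_orthogonal \<omega> \<longleftrightarrow> \<omega> \<subseteq> right_perp \<omega>"

(* W_n \<rightarrow> ... \<rightarrow> W_0 \<rightarrow> A spliced from n E-triangles K_(i+1) \<rightarrow> W_i \<rightarrow> K_i, with K_0 = A and
   K_n = W_n the cocone term at which the sequence begins; for n = 0 it reduces to A = W_0. *)
definition hat :: "'o set \<Rightarrow> 'o set" where
  "hat \<X> = {A \<in> Ob. \<exists>n W K. K 0 = A \<and> K n = W n \<and> (\<forall>i\<le>n. W i \<in> \<X>) \<and>
                 (\<forall>i<n. has_etriangle (K (Suc i)) (W i) (K i))}"

definition check :: "'o set \<Rightarrow> 'o set" where
  "check \<X> = {A \<in> Ob. \<exists>n W K. K 0 = A \<and> K n = W n \<and> (\<forall>i\<le>n. W i \<in> \<X>) \<and>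
                   (\<forall>i<n. has_etriangle (K i) (W i) (K (Suc i)))}"

definition tilde :: "'o set \<Rightarrow> 'o set" where
  "tilde \<omega> = check (hat \<omega>)"

definition X_class :: "'o set \<Rightarrow> 'o set" where
  "X_class \<omega> = {A \<in> Ob. \<exists>W K. K 0 = A \<and>
     (\<forall>i. W i \<in> \<omega> \<and> K i \<in> right_perp \<omega> \<and> has_etriangle (K (Suc i)) (W i) (K i))}"

end

end

theory Submission
  imports Defs
begin

text \<open>
  Let \<open>\<H>\<close> be \<open>hat \<omega>\<close> or \<open>X_class \<omega>\<close>. Every \<open>U \<in> \<H>\<close> is covered by some \<open>W \<in> \<omega>\<close> with cocone
  in \<open>\<H>\<close>, and every \<open>V\<close> in \<open>check \<omega>\<close> embeds into some \<open>W \<in> \<omega>\<close> with cone in \<open>check \<omega>\<close>; the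
  octahedral axioms applied to such a cover or embedding turn (3) into (2) and (2) into (3).
  Clearly (3) implies (1). Conversely, by induction on the length of an \<open>\<H>\<close>-coresolution
  \<open>M \<rightarrow> H \<rightarrow> K\<close>, \<open>\<dots>\<close>, form (2) for \<open>K\<close> is an extriangle \<open>U \<rightarrow> V \<rightarrow> K\<close>, and the pullback \<open>Y\<close> of \<open>V\<close> and
  \<open>H\<close> over \<open>K\<close> gives \<open>U \<rightarrow> Y \<rightarrow> H\<close> and \<open>M \<rightarrow> Y \<rightarrow> V\<close>, which is (3) because \<open>\<H>\<close> is closed under
  extensions. That closure is a horseshoe argument, using \<open>\<H> \<subseteq> right_perp \<omega>\<close>.
\<close>

section \<open>Zero morphisms, biproducts and isomorphisms in an additive category\<close>

context additive_category
begin

lemma Mor_is_group: "\<lbrakk>A \<in> Ob; B \<in> Ob\<rbrakk> \<Longrightarrow> group (Mor A B)"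
  using Mor_group comm_group.axioms(2) by blast

lemma zero_closed: "\<lbrakk>A \<in> Ob; B \<in> Ob\<rbrakk> \<Longrightarrow> \<one>\<^bsub>Mor A B\<^esub> \<in> carrier (Mor A B)"
  by (simp add: Mor_is_group group.is_monoid monoid.one_closed)

lemma Cmp_zero_right:
  "\<lbrakk>A \<in> Ob; B \<in> Ob; D \<in> Ob; g \<in> carrier (Mor B D)\<rbrakk> \<Longrightarrow> g \<cdot> \<one>\<^bsub>Mor A B\<^esub> = \<one>\<^bsub>Mor A D\<^esub>"
  using hom_one[OF Cmp_hom_right] Mor_is_group by blast

lemma Cmp_zero_left:
  "\<lbrakk>A \<in> Ob; B \<in> Ob; D \<in> Ob; f \<in> carrier (Mor A B)\<rbrakk> \<Longrightarrow> \<one>\<^bsub>Mor B D\<^esub> \<cdot> f = \<one>\<^bsub>Mor A D\<^esub>"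
  using hom_one[OF Cmp_hom_left] Mor_is_group by blast

text \<open>The identity of \<open>A\<close> already exhibits \<open>A\<close> as a direct sum with
  \<open>Z\<close>. Fed to \<open>realizes_zero\<close>, this gives the trivial extriangles with a
  zero object at one end.\<close>

lemma biproduct_zero_right:
  assumes Z: "is_zero_object \<C> Z" and A: "A \<in> Ob"
  shows "is_biproduct \<C> A A Z (Idt A) \<one>\<^bsub>Mor Z A\<^esub> (Idt A) \<one>\<^bsub>Mor A Z\<^esub>"
proof -
  have ZO: "Z \<in> Ob" using Z unfolding is_zero_object_def by simp
  interpret AA: group "Mor A A" using A A by (rule Mor_is_group)
  show ?thesis
    using Z A ZO unfolding is_biproduct_def is_zero_object_def
    by (auto simp: Idt_closed zero_closed Idt_left Idt_right Cmp_zero_left Cmp_zero_right)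
qed

lemma biproduct_zero_left:
  assumes Z: "is_zero_object \<C> Z" and A: "A \<in> Ob"
  shows "is_biproduct \<C> A Z A \<one>\<^bsub>Mor Z A\<^esub> (Idt A) \<one>\<^bsub>Mor A Z\<^esub> (Idt A)"
proof -
  have ZO: "Z \<in> Ob" using Z unfolding is_zero_object_def by simp
  interpret AA: group "Mor A A" using A A by (rule Mor_is_group)
  show ?thesis
    using Z A ZO unfolding is_biproduct_def is_zero_object_def
    by (auto simp: Idt_closed zero_closed Idt_left Idt_right Cmp_zero_left Cmp_zero_right)
qed

lemma biproduct_commute:
  assumes "is_biproduct \<C> S A B i j p q"
  shows "is_biproduct \<C> S B A j i q p"
proof -
  have SO: "S \<in> Ob" "A \<in> Ob" "B \<in> Ob"
    and m: "i \<in> carrier (Mor A S)" "j \<in> carrier (Mor B S)"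
    "p \<in> carrier (Mor S A)" "q \<in> carrier (Mor S B)"
    using assms unfolding is_biproduct_def by auto
  interpret SS: comm_group "Mor S S" using SO(1) SO(1) by (rule Mor_group)
  have "i \<cdot> p \<in> carrier (Mor S S)" "j \<cdot> q \<in> carrier (Mor S S)"
    using Cmp_closed[OF SO(1,2,1) m(3,1)] Cmp_closed[OF SO(1,3,1) m(4,2)] .
  then have "(j \<cdot> q) \<otimes>\<^bsub>Mor S S\<^esub> (i \<cdot> p) = (i \<cdot> p) \<otimes>\<^bsub>Mor S S\<^esub> (j \<cdot> q)"
    by (simp add: SS.m_comm)
  then show ?thesis using assms unfolding is_biproduct_def by auto
qed

lemma is_isoE:
  assumes "is_iso \<C> A B f"
  obtains g where "f \<in> carrier (Mor A B)" "is_iso \<C> B A g" "g \<cdot> f = Idt A" "f \<cdot> g = Idt B"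
  using assms unfolding is_iso_def by auto

lemma is_iso_mor: "is_iso \<C> A B f \<Longrightarrow> f \<in> carrier (Mor A B)"
  unfolding is_iso_def by auto

lemma Idt_is_iso: "A \<in> Ob \<Longrightarrow> is_iso \<C> A A (Idt A)"
  unfolding is_iso_def using Idt_closed Idt_left by blast

lemma Cmp_cancel_middle:
  assumes "A \<in> Ob" "B \<in> Ob" "D \<in> Ob" "F \<in> Ob" 
    and "f \<in> carrier (Mor A B)" "g \<in> carrier (Mor B D)" "g' \<in> carrier (Mor D B)"
    "h \<in> carrier (Mor B F)" and "g' \<cdot> g = Idt B"
  shows "(h \<cdot> g') \<cdot> (g \<cdot> f) = h \<cdot> f"
proof -
  have gf: "g \<cdot> f \<in> carrier (Mor A D)" using Cmp_closed[OF assms(1,2,3,5,6)] .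
  have "(h \<cdot> g') \<cdot> (g \<cdot> f) = h \<cdot> (g' \<cdot> (g \<cdot> f))"
    using Cmp_assoc[OF assms(1,3,2,4) gf assms(7,8)] by simp
  also have "g' \<cdot> (g \<cdot> f) = f"
    using Cmp_assoc[OF assms(1,2,3,2,5,6,7)] assms Idt_left by simp
  finally show ?thesis .
qed

lemma is_iso_Cmp:
  assumes O: "A \<in> Ob" "B \<in> Ob" "D \<in> Ob" and f: "is_iso \<C> A B f" and g: "is_iso \<C> B D g"
  shows "is_iso \<C> A D (g \<cdot> f)"
proof -
  obtain f' where f': "f' \<in> carrier (Mor B A)" "f' \<cdot> f = Idt A" "f \<cdot> f' = Idt B"
    using f unfolding is_iso_def by auto
  obtain g' where g': "g' \<in> carrier (Mor D B)" "g' \<cdot> g = Idt B" "g \<cdot> g' = Idt D"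
    using g unfolding is_iso_def by auto
  note fg = is_iso_mor[OF f] is_iso_mor[OF g]
  have "(f' \<cdot> g') \<cdot> (g \<cdot> f) = Idt A" "(g \<cdot> f) \<cdot> (f' \<cdot> g') = Idt D"
    using Cmp_cancel_middle[OF O(1,2,3,1) fg g'(1) f'(1) g'(2)]
      Cmp_cancel_middle[OF O(3,2,1,3) g'(1) f'(1) fg f'(3)] f' g' by simp_all
  then show ?thesis unfolding is_iso_def
    using Cmp_closed[OF O fg] Cmp_closed[OF O(3,2,1) g'(1) f'(1)] by auto
qed

text \<open>The hypotheses yield a left inverse \<open>s \<cdot> g\<close> and a right inverse
  \<open>g \<cdot> t\<close> of \<open>b\<close>, and these must coincide.\<close>

lemma is_iso_two_sided:
  assumes O: "A \<in> Ob" "B \<in> Ob" and b: "b \<in> carrier (Mor A B)" and g: "g \<in> carrier (Mor B A)"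
    and gb: "is_iso \<C> A A (g \<cdot> b)" and bg: "is_iso \<C> B B (b \<cdot> g)"
  shows "is_iso \<C> A B b"
proof -
  obtain s where s: "s \<in> carrier (Mor A A)" "s \<cdot> (g \<cdot> b) = Idt A"
    using gb unfolding is_iso_def by auto
  obtain t where t: "t \<in> carrier (Mor B B)" "(b \<cdot> g) \<cdot> t = Idt B"
    using bg unfolding is_iso_def by auto
  have sg: "s \<cdot> g \<in> carrier (Mor B A)" and gt: "g \<cdot> t \<in> carrier (Mor B A)"
    using Cmp_closed[OF O(2,1,1) g s(1)] Cmp_closed[OF O(2,2,1) t(1) g] .
  have l: "(s \<cdot> g) \<cdot> b = Idt A" using Cmp_assoc[OF O(1,2,1,1) b g s(1)] s(2) by simp
  have r: "b \<cdot> (g \<cdot> t) = Idt B" using Cmp_assoc[OF O(2,2,1,2) t(1) g b] t(2) by simp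
  have "s \<cdot> g = ((s \<cdot> g) \<cdot> b) \<cdot> (g \<cdot> t)"
    using Cmp_assoc[OF O(2,1,2,1) gt b sg] r Idt_right[OF O(2,1) sg] by simp
  then have "s \<cdot> g = g \<cdot> t" using l Idt_left[OF O(2,1) gt] by simp
  then show ?thesis unfolding is_iso_def using b sg l r by auto
qed

end


section \<open>Functoriality of the extension groups and uniqueness of realizations\<close>

context extriangulated_category
begin

lemma Ext_is_group: "\<lbrakk>C \<in> Ob; A \<in> Ob\<rbrakk> \<Longrightarrow> group (Ext C A)"
  using Ext_group comm_group.axioms(2) by blast

lemma Ext_one_closed: "\<lbrakk>C \<in> Ob; A \<in> Ob\<rbrakk> \<Longrightarrow> \<one>\<^bsub>Ext C A\<^esub> \<in> carrier (Ext C A)"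
  by (simp add: Ext_is_group group.is_monoid monoid.one_closed)

lemma ExtMap_closed:
  "\<lbrakk>C \<in> Ob; C' \<in> Ob; A \<in> Ob; A' \<in> Ob; c \<in> carrier (Mor C' C); a \<in> carrier (Mor A A');
    \<delta> \<in> carrier (Ext C A)\<rbrakk> \<Longrightarrow> ExtMap c a \<delta> \<in> carrier (Ext C' A')"
  using ExtMap_hom[of C C' A A' c a] by (auto simp: hom_def)

lemma ExtMap_mult:
  "\<lbrakk>C \<in> Ob; C' \<in> Ob; A \<in> Ob; A' \<in> Ob; c \<in> carrier (Mor C' C); a \<in> carrier (Mor A A');
    \<delta> \<in> carrier (Ext C A); \<epsilon> \<in> carrier (Ext C A)\<rbrakk>
    \<Longrightarrow> ExtMap c a (\<delta> \<otimes>\<^bsub>Ext C A\<^esub> \<epsilon>) = ExtMap c a \<delta> \<otimes>\<^bsub>Ext C' A'\<^esub> ExtMap c a \<epsilon>"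
  using ExtMap_hom[of C C' A A' c a] by (auto simp: hom_def)

lemma ExtMap_one:
  "\<lbrakk>C \<in> Ob; C' \<in> Ob; A \<in> Ob; A' \<in> Ob; c \<in> carrier (Mor C' C); a \<in> carrier (Mor A A')\<rbrakk>
    \<Longrightarrow> ExtMap c a \<one>\<^bsub>Ext C A\<^esub> = \<one>\<^bsub>Ext C' A'\<^esub>"
  using hom_one[OF ExtMap_hom] Ext_is_group by blast

text \<open>Additivity in the second variable makes the value idempotent, and a group has no
  idempotent besides its unit.\<close>

lemma ExtMap_zero_right:
  assumes O: "C \<in> Ob" "C' \<in> Ob" "A \<in> Ob" "A' \<in> Ob"
    and c: "c \<in> carrier (Mor C' C)" and \<delta>: "\<delta> \<in> carrier (Ext C A)"
  shows "ExtMap c \<one>\<^bsub>Mor A A'\<^esub> \<delta> = \<one>\<^bsub>Ext C' A'\<^esub>"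
proof -
  interpret M: group "Mor A A'" using O(3,4) by (rule Mor_is_group)
  interpret E: group "Ext C' A'" using O(2,4) by (rule Ext_is_group)
  have "ExtMap c \<one>\<^bsub>Mor A A'\<^esub> \<delta> = ExtMap c \<one>\<^bsub>Mor A A'\<^esub> \<delta> \<otimes>\<^bsub>Ext C' A'\<^esub> ExtMap c \<one>\<^bsub>Mor A A'\<^esub> \<delta>"
    using ExtMap_add_right[OF O c M.one_closed M.one_closed \<delta>] by simp
  then show ?thesis using ExtMap_closed[OF O c M.one_closed \<delta>] by (metis E.r_cancel_one')
qed

lemma push_closed:
  "\<lbrakk>C \<in> Ob; A \<in> Ob; A' \<in> Ob; a \<in> carrier (Mor A A'); \<delta> \<in> carrier (Ext C A)\<rbrakk>
    \<Longrightarrow> push \<C> C a \<delta> \<in> carrier (Ext C A')"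
  unfolding push_def using ExtMap_closed Idt_closed by blast

lemma pull_closed:
  "\<lbrakk>C \<in> Ob; C' \<in> Ob; A \<in> Ob; c \<in> carrier (Mor C' C); \<delta> \<in> carrier (Ext C A)\<rbrakk>
    \<Longrightarrow> pull \<C> A c \<delta> \<in> carrier (Ext C' A)"
  unfolding pull_def using ExtMap_closed Idt_closed by blast

lemma push_one:
  "\<lbrakk>C \<in> Ob; A \<in> Ob; A' \<in> Ob; a \<in> carrier (Mor A A')\<rbrakk> \<Longrightarrow> push \<C> C a \<one>\<^bsub>Ext C A\<^esub> = \<one>\<^bsub>Ext C A'\<^esub>"
  unfolding push_def using ExtMap_one Idt_closed by blast

lemma pull_one:
  "\<lbrakk>C \<in> Ob; C' \<in> Ob; A \<in> Ob; c \<in> carrier (Mor C' C)\<rbrakk> \<Longrightarrow> pull \<C> A c \<one>\<^bsub>Ext C A\<^esub> = \<one>\<^bsub>Ext C' A\<^esub>"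
  unfolding pull_def using ExtMap_one Idt_closed by blast

lemma push_Idt: "\<lbrakk>C \<in> Ob; A \<in> Ob; \<delta> \<in> carrier (Ext C A)\<rbrakk> \<Longrightarrow> push \<C> C (Idt A) \<delta> = \<delta>"
  unfolding push_def using ExtMap_Idt by blast

lemma pull_Idt: "\<lbrakk>C \<in> Ob; A \<in> Ob; \<delta> \<in> carrier (Ext C A)\<rbrakk> \<Longrightarrow> pull \<C> A (Idt C) \<delta> = \<delta>"
  unfolding pull_def using ExtMap_Idt by blast

lemma push_Cmp:
  assumes "C \<in> Ob" "A \<in> Ob" "A' \<in> Ob" "A'' \<in> Ob"
    "a \<in> carrier (Mor A A')" "a' \<in> carrier (Mor A' A'')" "\<delta> \<in> carrier (Ext C A)"
  shows "push \<C> C (a' \<cdot> a) \<delta> = push \<C> C a' (push \<C> C a \<delta>)"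
  unfolding push_def
  using ExtMap_Cmp[of C C C A A' A'' "Idt C" "Idt C" a a' \<delta>] assms
  by (simp add: Idt_closed Idt_left[of C C])

lemma pull_Cmp:
  assumes "C \<in> Ob" "C' \<in> Ob" "C'' \<in> Ob" "A \<in> Ob"
    "c \<in> carrier (Mor C' C)" "c' \<in> carrier (Mor C'' C')" "\<delta> \<in> carrier (Ext C A)"
  shows "pull \<C> A (c \<cdot> c') \<delta> = pull \<C> A c' (pull \<C> A c \<delta>)"
  unfolding pull_def
  using ExtMap_Cmp[of C C' C'' A A A c c' "Idt A" "Idt A" \<delta>] assms
  by (simp add: Idt_closed Idt_left[of A A])

text \<open>Both sides are \<open>ExtMap c a \<delta>\<close>, factored in the two possible
  orders.\<close>

lemma pull_push:
  assumes "C \<in> Ob" "C' \<in> Ob" "A \<in> Ob" "A' \<in> Ob"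
    "c \<in> carrier (Mor C' C)" "a \<in> carrier (Mor A A')" "\<delta> \<in> carrier (Ext C A)"
  shows "pull \<C> A' c (push \<C> C a \<delta>) = push \<C> C' a (pull \<C> A c \<delta>)"
  unfolding push_def pull_def
  using ExtMap_Cmp[of C C C' A A' A' "Idt C" c a "Idt A'" \<delta>]
    ExtMap_Cmp[of C C' C' A A A' c "Idt C'" "Idt A" a \<delta>] assms
  by (simp add: Idt_closed Idt_left[of C' C] Idt_left[of A A'] Idt_right[of C' C] Idt_right[of A A'])

lemma realizesD:
  assumes "realizes \<C> A x B y C \<delta>"
  shows "A \<in> Ob" "B \<in> Ob" "C \<in> Ob" "x \<in> carrier (Mor A B)" "y \<in> carrier (Mor B C)"
    "\<delta> \<in> carrier (Ext C A)"
  using assms unfolding realizes_def is_seq_def by auto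

lemma has_etriangleE:
  assumes "has_etriangle \<C> A B C"
  obtains x y \<delta> where "realizes \<C> A x B y C \<delta>"
  using assms unfolding has_etriangle_def etriangle_def by auto

lemma has_etriangleI: "realizes \<C> A x B y C \<delta> \<Longrightarrow> has_etriangle \<C> A B C"
  unfolding has_etriangle_def etriangle_def by auto

lemma has_etriangle_Ob: "has_etriangle \<C> A B C \<Longrightarrow> A \<in> Ob \<and> B \<in> Ob \<and> C \<in> Ob"
  by (meson has_etriangleE realizesD)

lemma realizes_Idt_left:
  "\<lbrakk>is_zero_object \<C> Z; A \<in> Ob\<rbrakk> \<Longrightarrow> realizes \<C> A (Idt A) A \<one>\<^bsub>Mor A Z\<^esub> Z \<one>\<^bsub>Ext Z A\<^esub>"
  using realizes_zero biproduct_zero_right by blast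

lemma realizes_Idt_right:
  "\<lbrakk>is_zero_object \<C> Z; A \<in> Ob\<rbrakk> \<Longrightarrow> realizes \<C> Z \<one>\<^bsub>Mor Z A\<^esub> A (Idt A) A \<one>\<^bsub>Ext A Z\<^esub>"
  using realizes_zero biproduct_zero_left by blast

text \<open>A sequence reached from \<open>B'\<close> by \<open>b'\<close> is reached from
  \<open>B\<close> by \<open>b' \<cdot> b\<close>. Using this for \<open>b\<close> and for its
  inverse gives equality of the two classes.\<close>

lemma seq_class_subset:
  assumes s: "is_seq \<C> A x B y C" and s': "is_seq \<C> A x' B' y' C"
    and b: "is_iso \<C> B B' b" and bx: "b \<cdot> x = x'" and yb: "y' \<cdot> b = y"
  shows "seq_class \<C> A x' B' y' C \<subseteq> seq_class \<C> A x B y C"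
proof -
  have "\<exists>c. is_iso \<C> B B'' c \<and> c \<cdot> x = x'' \<and> y'' \<cdot> c = y"
    if s'': "is_seq \<C> A x'' B'' y'' C" and b': "is_iso \<C> B' B'' b'" and b'x: "b' \<cdot> x' = x''"
      and yb': "y'' \<cdot> b' = y'" for x'' B'' y'' b'
  proof -
    have O: "A \<in> Ob" "B \<in> Ob" "B' \<in> Ob" "B'' \<in> Ob" "C \<in> Ob"
      and m: "x \<in> carrier (Mor A B)" "y'' \<in> carrier (Mor B'' C)"
      using s s' s'' unfolding is_seq_def by auto
    note bb = is_iso_mor[OF b] is_iso_mor[OF b']
    have "(b' \<cdot> b) \<cdot> x = x''" using Cmp_assoc[OF O(1-4) m(1) bb] bx b'x by simp
    moreover have "y'' \<cdot> (b' \<cdot> b) = y" using Cmp_assoc[OF O(2-5) bb m(2)] yb yb' by simp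
    ultimately show ?thesis using is_iso_Cmp[OF O(2-4) b b'] by blast
  qed
  then show ?thesis unfolding seq_class_def by blast
qed

lemma realizes_middle_iso:
  assumes r: "realizes \<C> A x B y C \<delta>" and s': "is_seq \<C> A x' B' y' C"
    and b: "is_iso \<C> B B' b" and bx: "b \<cdot> x = x'" and yb: "y' \<cdot> b = y"
  shows "realizes \<C> A x' B' y' C \<delta>"
proof -
  have s: "is_seq \<C> A x B y C" using r unfolding realizes_def by simp
  have O: "A \<in> Ob" "B \<in> Ob" "B' \<in> Ob" "C \<in> Ob"
    and m: "x \<in> carrier (Mor A B)" "y' \<in> carrier (Mor B' C)"
    using s s' unfolding is_seq_def by auto
  obtain b' where b': "b \<in> carrier (Mor B B')" "is_iso \<C> B' B b'" "b' \<cdot> b = Idt B" "b \<cdot> b' = Idt B'"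
    using is_isoE[OF b] .
  note m' = is_iso_mor[OF b'(2)]
  have "b' \<cdot> x' = x" 
    using Cmp_assoc[OF O(1,2,3,2) m(1) b'(1) m'] b' bx Idt_left[OF O(1,2) m(1)] by simp
  moreover have "y \<cdot> b' = y'"
    using Cmp_assoc[OF O(3,2,3,4) m' b'(1) m(2)] b' yb Idt_right[OF O(3,4) m(2)] by simp
  ultimately have "seq_class \<C> A x B y C = seq_class \<C> A x' B' y' C"
    using seq_class_subset[OF s s' b bx yb] seq_class_subset[OF s' s b'(2)] by blast
  then show ?thesis using r s' unfolding realizes_def by simp
qed

text \<open>The second sequence lies in its own class by the identity, and both classes are
  \<open>Rlz C A \<delta>\<close>.\<close>

lemma realizes_middle_unique:
  assumes r: "realizes \<C> A x B y C \<delta>" and r': "realizes \<C> A x' B' y' C \<delta>"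
  shows "\<exists>b. is_iso \<C> B B' b \<and> b \<cdot> x = x' \<and> y' \<cdot> b = y"
proof -
  note D = realizesD[OF r']
  have "(x', B', y') \<in> seq_class \<C> A x' B' y' C"
    using r' Idt_is_iso[OF D(2)] Idt_left[OF D(1,2,4)] Idt_right[OF D(2,3,5)]
    unfolding seq_class_def realizes_def by blast
  also have "\<dots> = seq_class \<C> A x B y C" using r r' unfolding realizes_def by simp
  finally show ?thesis unfolding seq_class_def by blast
qed

section \<open>Exact sequences of an extriangle\<close>

text \<open>The pair \<open>Idt B\<close>, \<open>y\<close> maps the trivial extriangle 0 ->
  \<open>B\<close> -> \<open>B\<close> to the given one, so \<open>ET3op\<close> writes the pulled
  back element as a push of zero.\<close>

lemma pull_deflation:
  assumes r: "realizes \<C> A x B y C \<delta>"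
  shows "pull \<C> A y \<delta> = \<one>\<^bsub>Ext B A\<^esub>"
proof -
  note D = realizesD[OF r]
  obtain Z where Z: "is_zero_object \<C> Z" using zero_object_exists by auto
  note r0 = realizes_Idt_right[OF Z D(2)]
  obtain a where "a \<in> carrier (Mor Z A)" "push \<C> B a \<one>\<^bsub>Ext B Z\<^esub> = pull \<C> A y \<delta>"
    using ET3op[OF r0 r Idt_closed[OF D(2)] D(5)] by auto
  then show ?thesis using push_one realizesD(1)[OF r0] D by metis
qed

text \<open>Exactness of Mor(X,B) -> Mor(X,C) -> E(X,A) in the middle. As the obstruction vanishes,
  \<open>c\<close> extends to a morphism from the split extriangle on \<open>A\<close> and
  \<open>X\<close>; its middle map composed with the inclusion \<open>j\<close> is the lift.\<close>

lemma lift_along_deflation: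
  assumes r: "realizes \<C> A x B y C \<delta>" and X: "X \<in> Ob" and c: "c \<in> carrier (Mor X C)"
    and z: "pull \<C> A c \<delta> = \<one>\<^bsub>Ext X A\<^esub>"
  shows "\<exists>b \<in> carrier (Mor X B). y \<cdot> b = c"
proof -
  note D = realizesD[OF r]
  obtain S i j p q where S: "is_biproduct \<C> S A X i j p q" using biproduct_exists[OF D(1) X] by blast
  then have SO: "S \<in> Ob" and j: "j \<in> carrier (Mor X S)" and q: "q \<in> carrier (Mor S X)"
    and qj: "q \<cdot> j = Idt X" unfolding is_biproduct_def by auto
  have "push \<C> X (Idt A) \<one>\<^bsub>Ext X A\<^esub> = pull \<C> A c \<delta>"
    using z push_one[OF X D(1) D(1) Idt_closed[OF D(1)]] by simp
  then obtain b where b: "b \<in> carrier (Mor S B)" "y \<cdot> b = c \<cdot> q"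
    using realization_mor[OF realizes_zero[OF S] r Idt_closed[OF D(1)] c] by auto
  have "y \<cdot> (b \<cdot> j) = c"
    using Cmp_assoc[OF X SO D(2,3) j b(1) D(5)] b(2) Cmp_assoc[OF X SO X D(3) j q c] qj
      Idt_right[OF X D(3) c] by simp
  then show ?thesis using Cmp_closed[OF X SO D(2) j b(1)] by blast
qed

text \<open>The inflation \<open>x\<close> is a weak kernel of \<open>y\<close>: since
  \<open>y \<cdot> f\<close> vanishes, \<open>f\<close> maps the trivial extriangle \<open>X\<close>
  -> \<open>X\<close> -> 0 to the given one, and \<open>ET3op\<close> supplies the factor.\<close>

lemma factor_through_kernel:
  assumes r: "realizes \<C> A x B y C \<delta>" and X: "X \<in> Ob" and f: "f \<in> carrier (Mor X B)"
    and z: "y \<cdot> f = \<one>\<^bsub>Mor X C\<^esub>"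
  shows "\<exists>g \<in> carrier (Mor X A). f = x \<cdot> g"
proof -
  note D = realizesD[OF r]
  obtain Z where Z: "is_zero_object \<C> Z" using zero_object_exists by auto
  note r0 = realizes_Idt_left[OF Z X]
  note D0 = realizesD[OF r0]
  have "\<one>\<^bsub>Mor Z C\<^esub> \<cdot> \<one>\<^bsub>Mor X Z\<^esub> = y \<cdot> f"
    using z Cmp_zero_left[OF X D0(3) D(3) D0(5)] by simp
  then obtain g where "g \<in> carrier (Mor X A)" "f \<cdot> Idt X = x \<cdot> g"
    using ET3op[OF r0 r f zero_closed[OF D0(3) D(3)]] by blast
  then show ?thesis using Idt_right[OF X D(2) f] by auto
qed

lemma factor_through_cokernel:
  assumes r: "realizes \<C> A x B y C \<delta>" and X: "X \<in> Ob" and f: "f \<in> carrier (Mor B X)"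
    and z: "f \<cdot> x = \<one>\<^bsub>Mor A X\<^esub>"
  shows "\<exists>g \<in> carrier (Mor C X). f = g \<cdot> y"
proof -
  note D = realizesD[OF r]
  obtain Z where Z: "is_zero_object \<C> Z" using zero_object_exists by auto
  note r0 = realizes_Idt_right[OF Z X]
  note D0 = realizesD[OF r0]
  have "f \<cdot> x = \<one>\<^bsub>Mor Z X\<^esub> \<cdot> \<one>\<^bsub>Mor A Z\<^esub>"
    using z Cmp_zero_left[OF D(1) D0(1) X zero_closed[OF D(1) D0(1)]] by simp
  then obtain g where "g \<in> carrier (Mor C X)" "g \<cdot> y = Idt X \<cdot> f"
    using ET3[OF r r0 zero_closed[OF D(1) D0(1)] f] by blast
  then show ?thesis using Idt_left[OF D(2) X f] by auto
qed

text \<open>Writing \<open>e = 1 + u\<close>, the map \<open>u\<close> factors both through \<open>x\<close> and through \<open>y\<close>, whence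
  \<open>e u = u = u e\<close> and \<open>1 - u\<close> is inverse to \<open>e\<close>.\<close>

lemma realizes_endomorphism_iso:
  assumes r: "realizes \<C> A x B y C \<delta>" and e: "e \<in> carrier (Mor B B)"
    and ex: "e \<cdot> x = x" and ye: "y \<cdot> e = y"
  shows "is_iso \<C> B B e"
proof -
  note D = realizesD[OF r]
  interpret BB: comm_group "Mor B B" using D(2) D(2) by (rule Mor_group)
  interpret AB: comm_group "Mor A B" using D(1) D(2) by (rule Mor_group)
  interpret BC: comm_group "Mor B C" using D(2) D(3) by (rule Mor_group)
  let ?I = "Idt B"
  have I: "?I \<in> carrier (Mor B B)" using Idt_closed D(2) .
  define u where "u = e \<otimes>\<^bsub>Mor B B\<^esub> inv\<^bsub>Mor B B\<^esub> ?I"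
  have u: "u \<in> carrier (Mor B B)" unfolding u_def using e I by simp
  interpret lx: group_hom "Mor B B" "Mor A B" "\<lambda>g. g \<cdot> x"
    using Cmp_hom_left[OF D(1,2,2,4)] BB.is_group AB.is_group
    by (simp add: group_hom_def group_hom_axioms_def)
  interpret ry: group_hom "Mor B B" "Mor B C" "\<lambda>f. y \<cdot> f"
    using Cmp_hom_right[OF D(2,2,3,5)] BB.is_group BC.is_group
    by (simp add: group_hom_def group_hom_axioms_def)
  interpret re: group_hom "Mor B B" "Mor B B" "\<lambda>f. e \<cdot> f"
    using Cmp_hom_right[OF D(2,2,2) e] BB.is_group
    by (simp add: group_hom_def group_hom_axioms_def)
  interpret le: group_hom "Mor B B" "Mor B B" "\<lambda>g. g \<cdot> e"
    using Cmp_hom_left[OF D(2,2,2) e] BB.is_group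
    by (simp add: group_hom_def group_hom_axioms_def)
  have "u \<cdot> x = \<one>\<^bsub>Mor A B\<^esub>"
    unfolding u_def using e I ex Idt_left[OF D(1,2,4)] D(4) by simp
  then obtain v where v: "v \<in> carrier (Mor C B)" "u = v \<cdot> y"
    using factor_through_cokernel[OF r D(2) u] by blast
  have "y \<cdot> u = \<one>\<^bsub>Mor B C\<^esub>"
    unfolding u_def using e I ye Idt_right[OF D(2,3,5)] D(5) by simp
  then obtain w where w: "w \<in> carrier (Mor B A)" "u = x \<cdot> w"
    using factor_through_kernel[OF r D(2) u] by blast
  have eu: "e \<cdot> u = u" using Cmp_assoc[OF D(2,1,2,2) w(1) D(4) e] ex w(2) by simp
  have ue: "u \<cdot> e = u" using Cmp_assoc[OF D(2,2,3,2) e D(5) v(1)] ye v(2) by simp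
  \<comment> \<open>Additively this is \<open>1 - u\<close>. What remains to be seen is
    \<open>e - u = 1\<close>, for then \<open>e (1 - u) = e - e u = e - u = 1\<close>.\<close>
  let ?e' = "?I \<otimes>\<^bsub>Mor B B\<^esub> inv\<^bsub>Mor B B\<^esub> u"
  have "e \<otimes>\<^bsub>Mor B B\<^esub> inv\<^bsub>Mor B B\<^esub> u = e \<otimes>\<^bsub>Mor B B\<^esub> (?I \<otimes>\<^bsub>Mor B B\<^esub> inv\<^bsub>Mor B B\<^esub> e)"
    unfolding u_def using e I BB.m_comm[of "inv\<^bsub>Mor B B\<^esub> e" ?I] by (simp add: BB.inv_mult)
  also have "\<dots> = ?I" using e I BB.m_lcomm[of e ?I "inv\<^bsub>Mor B B\<^esub> e"] by simp
  finally have eI: "e \<otimes>\<^bsub>Mor B B\<^esub> inv\<^bsub>Mor B B\<^esub> u = ?I" .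
  have "e \<cdot> ?e' = ?I" "?e' \<cdot> e = ?I"
    using eu ue eI I u e Idt_left[OF D(2,2) e] Idt_right[OF D(2,2) e] by simp_all
  then show ?thesis unfolding is_iso_def using e I u by blast
qed

text \<open>The new element is the pullback of \<open>\<delta>\<close> along the inverse of
  \<open>c\<close>. Comparison maps between its realization and the given sequence exist both ways;
  their composites fix both ends, hence are isomorphisms, so the given middle term may be
  used.\<close>

lemma realizes_cone_iso:
  assumes r: "realizes \<C> A x B y C \<delta>" and c: "is_iso \<C> C C' c" and C': "C' \<in> Ob"
  shows "\<exists>\<delta>'. realizes \<C> A x B (c \<cdot> y) C' \<delta>'"
proof -
  note D = realizesD[OF r]
  obtain c' where cc: "c \<in> carrier (Mor C C')" "is_iso \<C> C' C c'" "c' \<cdot> c = Idt C" "c \<cdot> c' = Idt C'"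
    using is_isoE[OF c] .
  have c': "c' \<in> carrier (Mor C' C)" using is_iso_mor[OF cc(2)] .
  define \<delta>' where "\<delta>' = pull \<C> A c' \<delta>"
  have \<delta>': "\<delta>' \<in> carrier (Ext C' A)" unfolding \<delta>'_def using pull_closed[OF D(3) C' D(1) c' D(6)] .
  obtain x' B' y' where r': "realizes \<C> A x' B' y' C' \<delta>'" using realization[OF C' D(1) \<delta>'] by blast
  note D' = realizesD[OF r']
  note IA = Idt_closed[OF D(1)]
  have "push \<C> C (Idt A) \<delta> = pull \<C> A c \<delta>'"
    unfolding \<delta>'_def
    using push_Idt[OF D(3,1,6)] pull_Cmp[OF D(3) C' D(3,1) c' cc(1) D(6)] cc(3) pull_Idt[OF D(3,1,6)]
    by simp
  then obtain b where b: "b \<in> carrier (Mor B B')" "b \<cdot> x = x'" "y' \<cdot> b = c \<cdot> y"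
    using realization_mor[OF r r' IA cc(1)] Idt_right[OF D'(1,2,4)] by auto
  have "push \<C> C' (Idt A) \<delta>' = pull \<C> A c' \<delta>"
    using push_Idt[OF D'(3,1,6)] \<delta>'_def by simp
  then obtain g where g: "g \<in> carrier (Mor B' B)" "g \<cdot> x' = x" "y \<cdot> g = c' \<cdot> y'"
    using realization_mor[OF r' r IA c'] Idt_right[OF D(1,2,4)] by auto
  have cy: "c \<cdot> y \<in> carrier (Mor B C')" using Cmp_closed[OF D(2,3) C' D(5) cc(1)] .
  have "(g \<cdot> b) \<cdot> x = x" using Cmp_assoc[OF D(1,2) D'(2) D(2) D(4) b(1) g(1)] b(2) g(2) by simp
  moreover have "y \<cdot> (g \<cdot> b) = y"
    using Cmp_assoc[OF D(2) D'(2) D(2,3) b(1) g(1) D(5)] g(3) b(3)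
      Cmp_assoc[OF D(2) D'(2,3) D(3) b(1) D'(5) c'] Cmp_assoc[OF D(2,3) C' D(3) D(5) cc(1) c']
      cc(3) Idt_left[OF D(2,3,5)] by simp
  ultimately have 1: "is_iso \<C> B B (g \<cdot> b)"
    using realizes_endomorphism_iso[OF r Cmp_closed[OF D(2) D'(2) D(2) b(1) g(1)]] by blast
  have "(b \<cdot> g) \<cdot> x' = x'"
    using Cmp_assoc[OF D(1) D'(2) D(2) D'(2) D'(4) g(1) b(1)] b(2) g(2) by simp
  moreover have "y' \<cdot> (b \<cdot> g) = y'"
    using Cmp_assoc[OF D'(2) D(2) D'(2,3) g(1) b(1) D'(5)] g(3) b(3)
      Cmp_assoc[OF D'(2) D(2,3) C' g(1) D(5) cc(1)] Cmp_assoc[OF D'(2,3) D(3) C' D'(5) c' cc(1)]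
      cc(4) Idt_left[OF D'(2,3,5)] by simp
  ultimately have 2: "is_iso \<C> B' B' (b \<cdot> g)"
    using realizes_endomorphism_iso[OF r' Cmp_closed[OF D'(2) D(2) D'(2) g(1) b(1)]] by blast
  have gi: "is_iso \<C> B' B g" using is_iso_two_sided[OF D'(2) D(2) g(1) b(1) 2 1] .
  have "(c \<cdot> y) \<cdot> g = y'"
    using Cmp_assoc[OF D'(2) D(2,3) C' g(1) D(5) cc(1)] g(3)
      Cmp_assoc[OF D'(2,3) D(3) C' D'(5) c' cc(1)] cc(4) Idt_left[OF D'(2,3,5)] by simp
  moreover have "is_seq \<C> A x B (c \<cdot> y) C'" unfolding is_seq_def using D C' cy by auto
  ultimately show ?thesis using realizes_middle_iso[OF r' _ gi g(2)] by blast
qed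

lemma has_etriangle_zero_left:
  "is_zero_object \<C> Z \<Longrightarrow> A \<in> Ob \<Longrightarrow> has_etriangle \<C> Z A A"
  using realizes_Idt_right has_etriangleI by blast

lemma has_etriangle_zero_right:
  "is_zero_object \<C> Z \<Longrightarrow> A \<in> Ob \<Longrightarrow> has_etriangle \<C> A A Z"
  using realizes_Idt_left has_etriangleI by blast

lemma has_etriangle_cone_iso:
  assumes "has_etriangle \<C> A B C" "is_iso \<C> C C' c" "C' \<in> Ob"
  shows "has_etriangle \<C> A B C'"
  using assms realizes_cone_iso has_etriangleE has_etriangleI by metis

text \<open>Exactness of E(X,A) -> E(X,B) -> E(X,C) in the middle. \<open>ET4\<close>, applied to
  the extriangle and a realization of \<open>\<theta>\<close>, shows that \<open>\<theta>\<close>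
  pulled back along \<open>e\<close> comes from \<open>A\<close>; a section of \<open>e\<close>
  carries this back to \<open>X\<close>.\<close>

lemma Ext_exact_middle:
  assumes r: "realizes \<C> A x B y C \<delta>" and X: "X \<in> Ob" and \<theta>: "\<theta> \<in> carrier (Ext X B)"
    and z: "push \<C> X y \<theta> = \<one>\<^bsub>Ext X C\<^esub>"
  shows "\<exists>\<eta> \<in> carrier (Ext X A). \<theta> = push \<C> X x \<eta>"
proof -
  note D = realizesD[OF r]
  obtain g W g' where rg: "realizes \<C> B g W g' X \<theta>" using realization[OF X D(2) \<theta>] by blast
  obtain E h h' d e \<delta>'' where r1: "realizes \<C> A h W h' E \<delta>''"
    and r2: "realizes \<C> C d E e X (push \<C> X y \<theta>)" and eq: "push \<C> E x \<delta>'' = pull \<C> B e \<theta>"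
    using ET4[OF r rg] by blast
  note D1 = realizesD[OF r1] and D2 = realizesD[OF r2]
  \<comment> \<open>The extriangle ending in \<open>e\<close> realizes
    \<open>push \<C> X y \<theta>\<close>, which is zero, so the identity of \<open>X\<close>
    lifts.\<close>
  obtain s where s: "s \<in> carrier (Mor X E)" "e \<cdot> s = Idt X"
    using lift_along_deflation[OF r2 X Idt_closed[OF X]] z pull_Idt[OF X D2(1) D2(6)] by auto
  have "\<theta> = pull \<C> B s (pull \<C> B e \<theta>)"
    using pull_Cmp[OF X D2(2) X D(2) D2(5) s(1) \<theta>] s(2) pull_Idt[OF X D(2) \<theta>] by simp
  also have "\<dots> = push \<C> X x (pull \<C> A s \<delta>'')"
    using eq pull_push[OF D2(2) X D(1,2) s(1) D(4) D1(6)] by simp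
  finally show ?thesis using pull_closed[OF D2(2) X D(1) s(1) D1(6)] by blast
qed

text \<open>Exactness of Mor(K,Y) -> E(X,Y) -> E(P,Y) in the middle: a lift of \<open>p\<close> to a
  realization of \<open>\<delta>\<close> gives a morphism of extriangles over the identity of
  \<open>X\<close>, whose first component is \<open>a\<close>.\<close>

lemma Ext_connecting_surj:
  assumes r: "realizes \<C> K k P p X \<eta>" and Y: "Y \<in> Ob" and \<delta>: "\<delta> \<in> carrier (Ext X Y)"
    and z: "pull \<C> Y p \<delta> = \<one>\<^bsub>Ext P Y\<^esub>"
  shows "\<exists>a \<in> carrier (Mor K Y). \<delta> = push \<C> X a \<eta>"
proof -
  note D = realizesD[OF r]
  obtain x B y where rb: "realizes \<C> Y x B y X \<delta>" using realization[OF D(3) Y \<delta>] by blast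
  obtain g where g: "g \<in> carrier (Mor P B)" "y \<cdot> g = p"
    using lift_along_deflation[OF rb D(2) D(5) z] by blast
  have "Idt X \<cdot> p = y \<cdot> g" using g(2) Idt_left[OF D(2,3,5)] by simp
  then obtain a where "a \<in> carrier (Mor K Y)" "push \<C> X a \<eta> = pull \<C> Y (Idt X) \<delta>"
    using ET3op[OF r rb g(1) Idt_closed[OF D(3)]] by blast
  then show ?thesis using pull_Idt[OF D(3) Y \<delta>] by auto
qed

text \<open>The identity of \<open>P\<close> lifts along the deflation \<open>y\<close>, while
  \<open>\<delta>\<close> dies when pulled back along \<open>y\<close>.\<close>

lemma projective_Ext_trivial:
  assumes P: "projective \<C> P" and Y: "Y \<in> Ob" and \<delta>: "\<delta> \<in> carrier (Ext P Y)"
  shows "\<delta> = \<one>\<^bsub>Ext P Y\<^esub>"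
proof -
  have PO: "P \<in> Ob" using P unfolding projective_def by simp
  obtain x B y where r: "realizes \<C> Y x B y P \<delta>" using realization[OF PO Y \<delta>] by blast
  note D = realizesD[OF r]
  obtain b where b: "b \<in> carrier (Mor P B)" "y \<cdot> b = Idt P"
    using P r Idt_closed[OF PO] unfolding projective_def etriangle_def by blast
  have "\<delta> = pull \<C> Y b (pull \<C> Y y \<delta>)"
    using pull_Cmp[OF PO D(2) PO Y D(5) b(1) \<delta>] b(2) pull_Idt[OF PO Y \<delta>] by simp
  then show ?thesis using pull_deflation[OF r] pull_one[OF D(2) PO Y b(1)] by simp
qed

section \<open>Pullbacks and octahedra, with the morphisms forgotten\<close>

text \<open>The pullback \<open>Z\<close> realizes the element \<open>\<theta>\<close> of E(C, A1 +
  A2) with components \<open>\<delta>1\<close> and \<open>\<delta>2\<close>. Composing either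
  summand inclusion with the inflation into \<open>Z\<close> and applying \<open>ET4\<close>
  produces the two extriangles.\<close>

lemma has_etriangle_pullback:
  assumes t1: "has_etriangle \<C> A1 B1 C" and t2: "has_etriangle \<C> A2 B2 C"
  shows "\<exists>Z. has_etriangle \<C> A1 Z B2 \<and> has_etriangle \<C> A2 Z B1"
proof -
  obtain x1 y1 \<delta>1 where r1: "realizes \<C> A1 x1 B1 y1 C \<delta>1" using t1 by (rule has_etriangleE)
  obtain x2 y2 \<delta>2 where r2: "realizes \<C> A2 x2 B2 y2 C \<delta>2" using t2 by (rule has_etriangleE)
  note D1 = realizesD[OF r1] and D2 = realizesD[OF r2]
  obtain S i j p q where S: "is_biproduct \<C> S A1 A2 i j p q"
    using biproduct_exists[OF D1(1) D2(1)] by blast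
  then have SO: "S \<in> Ob" and m: "i \<in> carrier (Mor A1 S)" "j \<in> carrier (Mor A2 S)"
    "p \<in> carrier (Mor S A1)" "q \<in> carrier (Mor S A2)"
    and eqs: "p \<cdot> i = Idt A1" "q \<cdot> j = Idt A2" "p \<cdot> j = \<one>\<^bsub>Mor A2 A1\<^esub>" "q \<cdot> i = \<one>\<^bsub>Mor A1 A2\<^esub>"
    unfolding is_biproduct_def by auto
  define \<theta> where "\<theta> = push \<C> C i \<delta>1 \<otimes>\<^bsub>Ext C S\<^esub> push \<C> C j \<delta>2"
  have c1: "push \<C> C i \<delta>1 \<in> carrier (Ext C S)" and c2: "push \<C> C j \<delta>2 \<in> carrier (Ext C S)"
    using push_closed[OF D1(3,1) SO m(1) D1(6)] push_closed[OF D1(3) D2(1) SO m(2) D2(6)] .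
  interpret CS: group "Ext C S" using D1(3) SO by (rule Ext_is_group)
  interpret C1: group "Ext C A1" using D1(3,1) by (rule Ext_is_group)
  interpret C2: group "Ext C A2" using D1(3) D2(1) by (rule Ext_is_group)
  have \<theta>: "\<theta> \<in> carrier (Ext C S)" unfolding \<theta>_def using c1 c2 by simp
  note IC = Idt_closed[OF D1(3)]
  have "push \<C> C p \<theta> = push \<C> C p (push \<C> C i \<delta>1) \<otimes>\<^bsub>Ext C A1\<^esub> push \<C> C p (push \<C> C j \<delta>2)"
    unfolding \<theta>_def push_def[of \<C> C p]
    using ExtMap_mult[OF D1(3,3) SO D1(1) IC m(3) c1 c2] .
  also have "push \<C> C p (push \<C> C i \<delta>1) = \<delta>1"
    using push_Cmp[OF D1(3,1) SO D1(1) m(1,3) D1(6)] eqs(1) push_Idt[OF D1(3,1,6)] by simp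
  also have "push \<C> C p (push \<C> C j \<delta>2) = \<one>\<^bsub>Ext C A1\<^esub>"
    using push_Cmp[OF D1(3) D2(1) SO D1(1) m(2,3) D2(6)] eqs(3)
      ExtMap_zero_right[OF D1(3,3) D2(1) D1(1) IC D2(6)] unfolding push_def by simp
  finally have p\<theta>: "push \<C> C p \<theta> = \<delta>1" using D1(6) by simp
  have "push \<C> C q \<theta> = push \<C> C q (push \<C> C i \<delta>1) \<otimes>\<^bsub>Ext C A2\<^esub> push \<C> C q (push \<C> C j \<delta>2)"
    unfolding \<theta>_def push_def[of \<C> C q]
    using ExtMap_mult[OF D1(3,3) SO D2(1) IC m(4) c1 c2] .
  also have "push \<C> C q (push \<C> C j \<delta>2) = \<delta>2"
    using push_Cmp[OF D1(3) D2(1) SO D2(1) m(2,4) D2(6)] eqs(2) push_Idt[OF D2(3,1,6)] by simp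
  also have "push \<C> C q (push \<C> C i \<delta>1) = \<one>\<^bsub>Ext C A2\<^esub>"
    using push_Cmp[OF D1(3) D1(1) SO D2(1) m(1,4) D1(6)] eqs(4)
      ExtMap_zero_right[OF D1(3,3) D1(1) D2(1) IC D1(6)] unfolding push_def by simp
  finally have q\<theta>: "push \<C> C q \<theta> = \<delta>2" using D2(6) by simp
  obtain g Z g' where rZ: "realizes \<C> S g Z g' C \<theta>" using realization[OF D1(3) SO \<theta>] by blast
  have "has_etriangle \<C> A1 Z B2"
  proof -
    \<comment> \<open>The element on the right arises as \<open>push \<C> C q \<theta>\<close>.
      Hence \<open>E\<close> and \<open>B2\<close> realize the same element and \<open>B2\<close>
      can replace \<open>E\<close> as cone.\<close>
    obtain E h h' d e \<delta>'' where E: "realizes \<C> A1 h Z h' E \<delta>''" "realizes \<C> A2 d E e C \<delta>2"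
      using ET4[OF realizes_zero[OF S] rZ] q\<theta> by metis
    then show ?thesis
      using realizes_middle_unique[OF E(2) r2] has_etriangle_cone_iso D2(2) has_etriangleI by blast
  qed
  moreover have "has_etriangle \<C> A2 Z B1"
  proof -
    obtain E h h' d e \<delta>'' where E: "realizes \<C> A2 h Z h' E \<delta>''" "realizes \<C> A1 d E e C \<delta>1"
      using ET4[OF realizes_zero[OF biproduct_commute[OF S]] rZ] p\<theta> by metis
    then show ?thesis
      using realizes_middle_unique[OF E(2) r1] has_etriangle_cone_iso D1(2) has_etriangleI by blast
  qed
  ultimately show ?thesis by blast
qed

lemma has_etriangle_ET4:
  assumes "has_etriangle \<C> A B D" "has_etriangle \<C> B C F"
  shows "\<exists>E. has_etriangle \<C> A C E \<and> has_etriangle \<C> D E F"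
proof -
  obtain f f' \<delta> g g' \<delta>' where "realizes \<C> A f B f' D \<delta>" "realizes \<C> B g C g' F \<delta>'"
    using assms by (elim has_etriangleE)
  from ET4[OF this] show ?thesis using has_etriangleI by blast
qed

lemma has_etriangle_ET4op:
  assumes "has_etriangle \<C> D A B" "has_etriangle \<C> F B C"
  shows "\<exists>E. has_etriangle \<C> E A C \<and> has_etriangle \<C> D E F"
proof -
  obtain f f' \<delta> g g' \<delta>' where "realizes \<C> D f' A f B \<delta>" "realizes \<C> F g' B g C \<delta>'"
    using assms by (elim has_etriangleE)
  from ET4op[OF this] show ?thesis using has_etriangleI by blast
qed

end


section \<open>The classes \<open>hat\<close>, \<open>check\<close> and \<open>X_class\<close>\<close>

context extriangulated_category
begin

lemma hatI:
  assumes "K 0 = A" "K n = W n" "A \<in> Ob" "\<And>i. i \<le> n \<Longrightarrow> W i \<in> \<X>"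
    "\<And>i. i < n \<Longrightarrow> has_etriangle \<C> (K (Suc i)) (W i) (K i)"
  shows "A \<in> hat \<C> \<X>"
  using assms unfolding hat_def by blast

lemma hat_base: "A \<in> \<X> \<Longrightarrow> A \<in> Ob \<Longrightarrow> A \<in> hat \<C> \<X>"
  by (rule hatI[of "\<lambda>_. A" A 0 "\<lambda>_. A"]) auto

lemma hat_step:
  assumes "has_etriangle \<C> K W A" "K \<in> hat \<C> \<X>" "W \<in> \<X>"
  shows "A \<in> hat \<C> \<X>"
proof -
  obtain n W' K' where *: "K' 0 = K" "K' n = W' n" "\<And>i. i \<le> n \<Longrightarrow> W' i \<in> \<X>"
    "\<And>i. i < n \<Longrightarrow> has_etriangle \<C> (K' (Suc i)) (W' i) (K' i)"
    using assms(2) unfolding hat_def by auto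
  \<comment> \<open>\<open>case_nat\<close> puts the new term in front and shifts the old sequence
    by one.\<close>
  have "has_etriangle \<C> (case_nat A K' (Suc i)) (case_nat W W' i) (case_nat A K' i)"
    if "i < Suc n" for i using * assms(1) that by (cases i) auto
  moreover have "case_nat W W' i \<in> \<X>" if "i \<le> Suc n" for i using * assms(3) that by (cases i) auto
  ultimately show ?thesis
    using * has_etriangle_Ob[OF assms(1)] hatI[of "case_nat A K'" A "Suc n" "case_nat W W'"] by simp
qed

text \<open>The indexed sequence is read as an inductive generation: starting at the far end
  \<open>K n\<close>, each extriangle adds one cone until \<open>K 0\<close> is reached.\<close>

lemma hat_induct [consumes 1, case_names base step]:
  assumes A: "A \<in> hat \<C> \<X>"
    and base: "\<And>A. A \<in> \<X> \<Longrightarrow> A \<in> Ob \<Longrightarrow> P A"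
    and step: "\<And>K W A. has_etriangle \<C> K W A \<Longrightarrow> K \<in> hat \<C> \<X> \<Longrightarrow> P K \<Longrightarrow> W \<in> \<X> \<Longrightarrow> P A"
  shows "P A"
proof -
  obtain n W K where *: "K 0 = A" "K n = W n" "\<And>i. i \<le> n \<Longrightarrow> W i \<in> \<X>"
    "\<And>i. i < n \<Longrightarrow> has_etriangle \<C> (K (Suc i)) (W i) (K i)" and AO: "A \<in> Ob"
    using A unfolding hat_def by auto
  \<comment> \<open>Index \<open>n - 1\<close> is the last spliced extriangle; for
    \<open>n = 0\<close> the object is \<open>A\<close> itself.\<close>
  have KO: "K n \<in> Ob"
    using *(1) *(4)[of "n - 1"] AO has_etriangle_Ob by (cases n) auto
  have "K i \<in> hat \<C> \<X> \<and> P (K i)" if "i \<le> n" for i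
    using that
  proof (induction i rule: inc_induct)
    case base
    show ?case using *(2,3) KO assms(2) hat_base by simp
  next
    case (step i)
    then show ?case using *(3,4) assms(3) hat_step by (meson less_imp_le)
  qed
  then show ?thesis using *(1) by auto
qed

lemma checkI:
  assumes "K 0 = A" "K n = W n" "A \<in> Ob" "\<And>i. i \<le> n \<Longrightarrow> W i \<in> \<X>"
    "\<And>i. i < n \<Longrightarrow> has_etriangle \<C> (K i) (W i) (K (Suc i))"
  shows "A \<in> check \<C> \<X>"
  using assms unfolding check_def by blast

lemma check_base: "A \<in> \<X> \<Longrightarrow> A \<in> Ob \<Longrightarrow> A \<in> check \<C> \<X>"
  by (rule checkI[of "\<lambda>_. A" A 0 "\<lambda>_. A"]) auto

lemma check_step:
  assumes "has_etriangle \<C> A W K" "K \<in> check \<C> \<X>" "W \<in> \<X>"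
  shows "A \<in> check \<C> \<X>"
proof -
  obtain n W' K' where *: "K' 0 = K" "K' n = W' n" "\<And>i. i \<le> n \<Longrightarrow> W' i \<in> \<X>"
    "\<And>i. i < n \<Longrightarrow> has_etriangle \<C> (K' i) (W' i) (K' (Suc i))"
    using assms(2) unfolding check_def by auto
  have "has_etriangle \<C> (case_nat A K' i) (case_nat W W' i) (case_nat A K' (Suc i))"
    if "i < Suc n" for i using * assms(1) that by (cases i) auto
  moreover have "case_nat W W' i \<in> \<X>" if "i \<le> Suc n" for i using * assms(3) that by (cases i) auto
  ultimately show ?thesis
    using * has_etriangle_Ob[OF assms(1)] checkI[of "case_nat A K'" A "Suc n" "case_nat W W'"] by simp
qed

lemma check_induct [consumes 1, case_names base step]:
  assumes A: "A \<in> check \<C> \<X>"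
    and base: "\<And>A. A \<in> \<X> \<Longrightarrow> A \<in> Ob \<Longrightarrow> P A"
    and step: "\<And>K W A. has_etriangle \<C> A W K \<Longrightarrow> K \<in> check \<C> \<X> \<Longrightarrow> P K \<Longrightarrow> W \<in> \<X> \<Longrightarrow> P A"
  shows "P A"
proof -
  obtain n W K where *: "K 0 = A" "K n = W n" "\<And>i. i \<le> n \<Longrightarrow> W i \<in> \<X>"
    "\<And>i. i < n \<Longrightarrow> has_etriangle \<C> (K i) (W i) (K (Suc i))" and AO: "A \<in> Ob"
    using A unfolding check_def by auto
  have KO: "K n \<in> Ob"
    using *(1) *(4)[of "n - 1"] AO has_etriangle_Ob by (cases n) auto
  have "K i \<in> check \<C> \<X> \<and> P (K i)" if "i \<le> n" for i
    using that
  proof (induction i rule: inc_induct)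
    case base
    show ?case using *(2,3) KO assms(2) check_base by simp
  next
    case (step i)
    then show ?case using *(3,4) assms(3) check_step by (meson less_imp_le)
  qed
  then show ?thesis using *(1) by auto
qed

lemma check_mono:
  assumes "\<X> \<subseteq> \<Y>" "A \<in> check \<C> \<X>"
  shows "A \<in> check \<C> \<Y>"
  using assms(2)
proof (induction rule: check_induct)
  case (base A)
  then show ?case using assms(1) check_base by blast
next
  case (step K W A)
  then show ?case using assms(1) check_step by blast
qed

lemma X_classI:
  assumes "K 0 = A" "A \<in> Ob"
    "\<And>i. W i \<in> \<omega> \<and> K i \<in> right_perp \<C> \<omega> \<and> has_etriangle \<C> (K (Suc i)) (W i) (K i)"
  shows "A \<in> X_class \<C> \<omega>"
  using assms unfolding X_class_def by blast

text \<open>Iterating a choice of covers inside \<open>S\<close> builds the infinite resolution.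
  This replaces induction, as resolutions in \<open>X_class\<close> have no last term.\<close>

lemma X_class_coinduct:
  assumes A: "A \<in> S" and S: "S \<subseteq> right_perp \<C> \<omega>"
    and step: "\<And>A. A \<in> S \<Longrightarrow> \<exists>K \<in> S. \<exists>W \<in> \<omega>. has_etriangle \<C> K W A"
  shows "A \<in> X_class \<C> \<omega>"
proof -
  obtain k w where kw: "\<And>A. A \<in> S \<Longrightarrow> k A \<in> S \<and> w A \<in> \<omega> \<and> has_etriangle \<C> (k A) (w A) A"
    using step by metis
  have "(k ^^ i) A \<in> S" for i using A kw by (induction i) auto
  then have "w ((k ^^ i) A) \<in> \<omega> \<and> (k ^^ i) A \<in> right_perp \<C> \<omega> \<and>
      has_etriangle \<C> ((k ^^ Suc i) A) (w ((k ^^ i) A)) ((k ^^ i) A)" for i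
    using kw S by auto
  moreover have "A \<in> Ob" using A S unfolding right_perp_def by auto
  ultimately show ?thesis
    using X_classI[of "\<lambda>i. (k ^^ i) A" A "\<lambda>i. w ((k ^^ i) A)" \<omega>] by simp
qed

lemma X_class_right_perp: "A \<in> X_class \<C> \<omega> \<Longrightarrow> A \<in> right_perp \<C> \<omega>"
  unfolding X_class_def by auto

lemma X_class_cover:
  assumes "A \<in> X_class \<C> \<omega>"
  shows "\<exists>K \<in> X_class \<C> \<omega>. \<exists>W \<in> \<omega>. has_etriangle \<C> K W A"
proof -
  obtain W K where *: "K 0 = A"
    "\<And>i. W i \<in> \<omega> \<and> K i \<in> right_perp \<C> \<omega> \<and> has_etriangle \<C> (K (Suc i)) (W i) (K i)"
    using assms unfolding X_class_def by auto
  have "K (Suc 0) \<in> X_class \<C> \<omega>"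
    using *(2) has_etriangle_Ob X_classI[of "\<lambda>i. K (Suc i)" _ "\<lambda>i. W (Suc i)"] by blast
  then show ?thesis using * by metis
qed

end

section \<open>The right perpendicular class, covers from \<open>\<omega>\<close> and closure under
  extensions\<close>

locale self_orthogonal_subcategory = extriangulated_category \<C>
  for \<C> :: "('o, 'm, 'e, 'z) extcat_scheme" (structure) +
  fixes \<omega> :: "'o set"
  assumes enough_proj: "enough_projectives \<C>"
    and subcat: "subcategory \<C> \<omega>"
    and self_orth: "self_orthogonal \<C> \<omega>"
begin

lemma omega_Ob: "W \<in> \<omega> \<Longrightarrow> W \<in> Ob"
  using subcat unfolding subcategory_def by auto

lemma omega_biproduct: "is_biproduct \<C> S A B i j p q \<Longrightarrow> A \<in> \<omega> \<Longrightarrow> B \<in> \<omega> \<Longrightarrow> S \<in> \<omega>"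
  using subcat unfolding subcategory_def by blast

lemma zero_object_in_omega: obtains Z where "is_zero_object \<C> Z" "Z \<in> \<omega>"
  using subcat unfolding subcategory_def by auto

lemma syzygy_etriangle:
  assumes "X \<in> Ob"
  shows "\<exists>P. projective \<C> P \<and> has_etriangle \<C> (syzygy \<C> X) P X"
proof -
  have "\<exists>K P. projective \<C> P \<and> has_etriangle \<C> K P X"
    using enough_proj assms unfolding enough_projectives_def by blast
  then show ?thesis unfolding syzygy_def by (rule someI_ex)
qed

lemma iterated_syzygy_Ob: "X \<in> Ob \<Longrightarrow> (syzygy \<C> ^^ i) X \<in> Ob"
  by (induction i) (use syzygy_etriangle has_etriangle_Ob in auto)

lemma right_perp_iff:
  "Y \<in> right_perp \<C> \<omega> \<longleftrightarrow> Y \<in> Ob \<and>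
     (\<forall>i. \<forall>X \<in> \<omega>. \<forall>\<delta> \<in> carrier (Ext ((syzygy \<C> ^^ i) X) Y). \<delta> = \<one>\<^bsub>Ext ((syzygy \<C> ^^ i) X) Y\<^esub>)"
proof -
  have *: "carrier (Ext Q Y) = {\<one>\<^bsub>Ext Q Y\<^esub>} \<longleftrightarrow> (\<forall>\<delta> \<in> carrier (Ext Q Y). \<delta> = \<one>\<^bsub>Ext Q Y\<^esub>)"
    if "Q \<in> Ob" "Y \<in> Ob" for Q using Ext_one_closed[OF that] by auto
  \<comment> \<open>\<open>higher_ext i\<close> takes \<open>i - 1\<close> syzygies, so the indices
    \<open>i \<ge> 1\<close> run through all iterates, the zeroth included.\<close>
  have shift: "(\<forall>i\<ge>1. \<Phi> (i - 1)) \<longleftrightarrow> (\<forall>i. \<Phi> i)" for \<Phi> :: "nat \<Rightarrow> bool"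
    by (auto dest: spec[of _ "Suc _"])
  have "Y \<in> right_perp \<C> \<omega> \<longleftrightarrow> Y \<in> Ob \<and>
     (\<forall>i. \<forall>X \<in> \<omega>. carrier (Ext ((syzygy \<C> ^^ i) X) Y) = {\<one>\<^bsub>Ext ((syzygy \<C> ^^ i) X) Y\<^esub>})"
    unfolding right_perp_def higher_ext_def using shift
      [of "\<lambda>i. \<forall>X \<in> \<omega>. carrier (Ext ((syzygy \<C> ^^ i) X) Y) = {\<one>\<^bsub>Ext ((syzygy \<C> ^^ i) X) Y\<^esub>}"]
    by simp
  then show ?thesis using * iterated_syzygy_Ob omega_Ob by meson
qed

lemma right_perp_extension:
  assumes t: "has_etriangle \<C> U Y V" and U: "U \<in> right_perp \<C> \<omega>" and V: "V \<in> right_perp \<C> \<omega>"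
  shows "Y \<in> right_perp \<C> \<omega>"
proof -
  obtain x y \<delta> where r: "realizes \<C> U x Y y V \<delta>" using t by (rule has_etriangleE)
  note D = realizesD[OF r]
  have "\<epsilon> = \<one>\<^bsub>Ext Q Y\<^esub>" if "X \<in> \<omega>" and Q: "Q = (syzygy \<C> ^^ i) X" and \<epsilon>: "\<epsilon> \<in> carrier (Ext Q Y)"
    for i X Q \<epsilon>
  proof -
    have QO: "Q \<in> Ob" using iterated_syzygy_Ob omega_Ob that by auto
    have "push \<C> Q y \<epsilon> = \<one>\<^bsub>Ext Q V\<^esub>"
      using V push_closed[OF QO D(2,3,5) \<epsilon>] that(1) Q unfolding right_perp_iff by auto
    then obtain \<eta> where "\<eta> \<in> carrier (Ext Q U)" "\<epsilon> = push \<C> Q x \<eta>"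
      using Ext_exact_middle[OF r QO \<epsilon>] by blast
    then show ?thesis using U that(1) Q push_one[OF QO D(1,2,4)] unfolding right_perp_iff by auto
  qed
  then show ?thesis unfolding right_perp_iff using D(2) by blast
qed

text \<open>Dimension shift: E^i(X,Y) sits between E^i(X,V) and E^(i+1)(X,U). Concretely,
  \<open>\<epsilon>\<close> is induced by a map \<open>a\<close> from the syzygy of
  \<open>Q\<close>; the obstruction to lifting \<open>a\<close> to \<open>V\<close> is an extension
  by \<open>U\<close>, and the lift \<open>b\<close> makes \<open>\<epsilon>\<close> the image of an
  extension by \<open>V\<close>.\<close>

lemma right_perp_cone:
  assumes t: "has_etriangle \<C> U V Y" and U: "U \<in> right_perp \<C> \<omega>" and V: "V \<in> right_perp \<C> \<omega>"
  shows "Y \<in> right_perp \<C> \<omega>"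
proof -
  obtain x y \<delta> where r: "realizes \<C> U x V y Y \<delta>" using t by (rule has_etriangleE)
  note D = realizesD[OF r]
  have "\<epsilon> = \<one>\<^bsub>Ext Q Y\<^esub>" if X: "X \<in> \<omega>" and Q: "Q = (syzygy \<C> ^^ i) X" and \<epsilon>: "\<epsilon> \<in> carrier (Ext Q Y)"
    for i X Q \<epsilon>
  proof -
    have QO: "Q \<in> Ob" using iterated_syzygy_Ob omega_Ob that by auto
    obtain P k p \<eta> where P: "projective \<C> P" and rs: "realizes \<C> (syzygy \<C> Q) k P p Q \<eta>"
      using syzygy_etriangle[OF QO] has_etriangleE by metis
    note Ds = realizesD[OF rs]
    have "pull \<C> Y p \<epsilon> = \<one>\<^bsub>Ext P Y\<^esub>"
      using projective_Ext_trivial[OF P D(3)] pull_closed[OF QO Ds(2) D(3) Ds(5) \<epsilon>] by blast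
    then obtain a where a: "a \<in> carrier (Mor (syzygy \<C> Q) Y)" "\<epsilon> = push \<C> Q a \<eta>"
      using Ext_connecting_surj[OF rs D(3) \<epsilon>] by blast
    have "syzygy \<C> Q = (syzygy \<C> ^^ Suc i) X" using Q by simp
    moreover have "pull \<C> U a \<delta> \<in> carrier (Ext (syzygy \<C> Q) U)"
      using pull_closed[OF D(3) Ds(1) D(1) a(1) D(6)] .
    ultimately have "pull \<C> U a \<delta> = \<one>\<^bsub>Ext (syzygy \<C> Q) U\<^esub>"
      using U X unfolding right_perp_iff by metis
    then obtain b where b: "b \<in> carrier (Mor (syzygy \<C> Q) V)" "y \<cdot> b = a"
      using lift_along_deflation[OF r Ds(1) a(1)] by blast
    have "push \<C> Q b \<eta> = \<one>\<^bsub>Ext Q V\<^esub>"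
      using V X Q push_closed[OF QO Ds(1) D(2) b(1) Ds(6)] unfolding right_perp_iff by auto
    then show ?thesis
      using a(2) push_Cmp[OF QO Ds(1) D(2,3) b(1) D(5) Ds(6)] b(2) push_one[OF QO D(2,3,5)] by simp
  qed
  then show ?thesis unfolding right_perp_iff using D(3) by blast
qed

lemma omega_right_perp: "W \<in> \<omega> \<Longrightarrow> W \<in> right_perp \<C> \<omega>"
  using self_orth unfolding self_orthogonal_def by blast

lemma Ext_omega_right_perp:
  "\<lbrakk>W \<in> \<omega>; Y \<in> right_perp \<C> \<omega>; \<delta> \<in> carrier (Ext W Y)\<rbrakk> \<Longrightarrow> \<delta> = \<one>\<^bsub>Ext W Y\<^esub>"
  unfolding right_perp_iff by (metis funpow_0)

text \<open>The extriangle \<open>U \<rightarrow> P \<rightarrow> W0\<close> splits, so \<open>W \<oplus> W0 \<rightarrow> U \<oplus> W0\<close> is the required cover of \<open>P\<close>.\<close>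

lemma cover_extension_by_omega:
  assumes t: "has_etriangle \<C> U P W0" and W0: "W0 \<in> \<omega>" and U: "U \<in> right_perp \<C> \<omega>"
    and c: "has_etriangle \<C> U1 W U" and W: "W \<in> \<omega>"
  shows "\<exists>W' \<in> \<omega>. has_etriangle \<C> U1 W' P"
proof -
  obtain x y \<delta> where r: "realizes \<C> U x P y W0 \<delta>" using t by (rule has_etriangleE)
  note D = realizesD[OF r]
  have r: "realizes \<C> U x P y W0 \<one>\<^bsub>Ext W0 U\<^esub>" using r Ext_omega_right_perp[OF W0 U D(6)] by simp
  obtain Q iQ jQ pQ qQ where Q: "is_biproduct \<C> Q U W0 iQ jQ pQ qQ"
    using biproduct_exists[OF D(1,3)] by blast
  obtain b where b: "is_iso \<C> Q P b" using realizes_middle_unique[OF realizes_zero[OF Q] r] by blast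
  obtain x1 y1 \<delta>1 where r1: "realizes \<C> U1 x1 W y1 U \<delta>1" using c by (rule has_etriangleE)
  note D1 = realizesD[OF r1]
  obtain S iS jS pS qS where S: "is_biproduct \<C> S W W0 iS jS pS qS"
    using biproduct_exists[OF D1(2) D(3)] by blast
  obtain Z where Z: "is_zero_object \<C> Z" using zero_object_exists by blast
  have "has_etriangle \<C> U1 S Q"
    using realizes_sum[OF r1 realizes_Idt_right[OF Z D(3)] biproduct_zero_right[OF Z D1(1)] S Q]
      has_etriangleI by blast
  then show ?thesis using has_etriangle_cone_iso[OF _ b D(2)] omega_biproduct[OF S W W0] by blast
qed

text \<open>The pullback \<open>P\<close> of \<open>Y\<close> and \<open>W0\<close> over
  \<open>V\<close> is an extension of \<open>W0\<close> by \<open>U\<close>, so it has a cover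
  \<open>W'\<close> with cocone \<open>U1\<close>. Composing with \<open>P\<close> ->
  \<open>Y\<close>, whose cocone is \<open>V1\<close>, \<open>ET4op\<close> presents the new cocone
  as an extension of \<open>V1\<close> by \<open>U1\<close>.\<close>

lemma horseshoe:
  assumes t: "has_etriangle \<C> U Y V" and U: "U \<in> right_perp \<C> \<omega>"
    and cU: "has_etriangle \<C> U1 W U" and W: "W \<in> \<omega>"
    and cV: "has_etriangle \<C> V1 W0 V" and W0: "W0 \<in> \<omega>"
  shows "\<exists>K. \<exists>W' \<in> \<omega>. has_etriangle \<C> K W' Y \<and> has_etriangle \<C> U1 K V1"
proof -
  obtain P where P: "has_etriangle \<C> U P W0" "has_etriangle \<C> V1 P Y"
    using has_etriangle_pullback[OF t cV] by blast
  obtain W' where "W' \<in> \<omega>" "has_etriangle \<C> U1 W' P"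
    using cover_extension_by_omega[OF P(1) W0 U cU W] by blast
  then show ?thesis using has_etriangle_ET4op[OF _ P(2)] by blast
qed

lemma hat_right_perp: "A \<in> hat \<C> \<omega> \<Longrightarrow> A \<in> right_perp \<C> \<omega>"
  by (induction rule: hat_induct) (auto intro: omega_right_perp right_perp_cone)

text \<open>An object of \<open>\<omega>\<close> covers itself with zero cocone; otherwise the first
  extriangle of the resolution serves.\<close>

lemma hat_cover:
  assumes "A \<in> hat \<C> \<omega>"
  shows "\<exists>K \<in> hat \<C> \<omega>. \<exists>W \<in> \<omega>. has_etriangle \<C> K W A"
  using assms
proof (induction rule: hat_induct)
  case (base A)
  obtain Z where "is_zero_object \<C> Z" "Z \<in> \<omega>" by (rule zero_object_in_omega)
  then show ?case using base has_etriangle_zero_left hat_base omega_Ob by meson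
qed blast

text \<open>Induction on the resolution of \<open>V\<close>. The horseshoe cocone is an extension of
  the shorter \<open>K\<close> by the cocone \<open>U1\<close> of a cover of \<open>U\<close>, which
  is why \<open>U\<close> and \<open>Y\<close> must vary in the induction hypothesis.\<close>

lemma hat_extension:
  assumes "V \<in> hat \<C> \<omega>" and "has_etriangle \<C> U Y V" and "U \<in> hat \<C> \<omega>"
  shows "Y \<in> hat \<C> \<omega>"
  using assms
proof (induction arbitrary: U Y rule: hat_induct)
  case (base V)
  then show ?case using hat_cover cover_extension_by_omega hat_right_perp hat_step by metis
next
  case (step K W V)
  obtain U1 W1 where "U1 \<in> hat \<C> \<omega>" "W1 \<in> \<omega>" "has_etriangle \<C> U1 W1 U"
    using hat_cover[OF step.prems(2)] by blast
  then show ?case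
    using horseshoe[OF step.prems(1) hat_right_perp[OF step.prems(2)] _ _ step.hyps(1) step.hyps(3)]
      step.IH hat_step by metis
qed

lemma omega_X_class:
  assumes "W \<in> \<omega>" shows "W \<in> X_class \<C> \<omega>"
proof -
  obtain Z where "is_zero_object \<C> Z" "Z \<in> \<omega>" by (rule zero_object_in_omega)
  then show ?thesis
    using X_class_coinduct[of W \<omega> \<omega>] assms self_orth has_etriangle_zero_left omega_Ob
    unfolding self_orthogonal_def by metis
qed

text \<open>Adjoining \<open>A\<close> to the class keeps it coinductively closed, since the cover
  of \<open>A\<close> has its cocone in the old class; orthogonality of \<open>A\<close> is
  \<open>right_perp_cone\<close>.\<close>

lemma X_class_step:
  assumes "has_etriangle \<C> K W A" "K \<in> X_class \<C> \<omega>" "W \<in> \<omega>"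
  shows "A \<in> X_class \<C> \<omega>"
proof (rule X_class_coinduct[of A "insert A (X_class \<C> \<omega>)"])
  show "insert A (X_class \<C> \<omega>) \<subseteq> right_perp \<C> \<omega>"
    using assms X_class_right_perp omega_right_perp right_perp_cone by blast
qed (use assms X_class_cover in auto)

text \<open>Coinduction on the class of all extensions of two members: the horseshoe cocone is again
  such an extension.\<close>

lemma X_class_extension:
  assumes "V \<in> X_class \<C> \<omega>" and "has_etriangle \<C> U Y V" and "U \<in> X_class \<C> \<omega>"
  shows "Y \<in> X_class \<C> \<omega>"
proof (rule X_class_coinduct)
  let ?S = "{Y. \<exists>U \<in> X_class \<C> \<omega>. \<exists>V \<in> X_class \<C> \<omega>. has_etriangle \<C> U Y V}"
  show "Y \<in> ?S" using assms by blast
  show "?S \<subseteq> right_perp \<C> \<omega>" using right_perp_extension X_class_right_perp by blast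
  show "\<exists>K \<in> ?S. \<exists>W \<in> \<omega>. has_etriangle \<C> K W Y" if Y: "Y \<in> ?S" for Y
  proof -
    obtain U V where UV: "U \<in> X_class \<C> \<omega>" "V \<in> X_class \<C> \<omega>" "has_etriangle \<C> U Y V"
      using Y by blast
    obtain U1 W where "U1 \<in> X_class \<C> \<omega>" "W \<in> \<omega>" "has_etriangle \<C> U1 W U"
      using X_class_cover[OF UV(1)] by blast
    moreover obtain V1 W0 where "V1 \<in> X_class \<C> \<omega>" "W0 \<in> \<omega>" "has_etriangle \<C> V1 W0 V"
      using X_class_cover[OF UV(2)] by blast
    ultimately show ?thesis using horseshoe[OF UV(3) X_class_right_perp[OF UV(1)]] by blast
  qed
qed

lemma check_omega_embedding:
  assumes "A \<in> check \<C> \<omega>"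
  shows "\<exists>K \<in> check \<C> \<omega>. \<exists>W \<in> \<omega>. has_etriangle \<C> A W K"
  using assms
proof (induction rule: check_induct)
  case (base A)
  obtain Z where "is_zero_object \<C> Z" "Z \<in> \<omega>" by (rule zero_object_in_omega)
  then show ?case using base has_etriangle_zero_right check_base omega_Ob by meson
qed blast

end

section \<open>The equivalence for a class covered by \<open>\<omega>\<close>\<close>

text \<open>These are the common properties of \<open>hat \<C> \<omega>\<close> and
  \<open>X_class \<C> \<omega>\<close>, so that both variants of the equivalence follow from one
  argument.\<close>

locale omega_covered_class = self_orthogonal_subcategory +
  fixes \<H> :: "'a set"
  assumes omega_subset: "\<omega> \<subseteq> \<H>"
    and cover: "A \<in> \<H> \<Longrightarrow> \<exists>K \<in> \<H>. \<exists>W \<in> \<omega>. has_etriangle \<C> K W A"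
    and cone: "\<lbrakk>has_etriangle \<C> K W A; K \<in> \<H>; W \<in> \<omega>\<rbrakk> \<Longrightarrow> A \<in> \<H>"
    and extension: "\<lbrakk>V \<in> \<H>; has_etriangle \<C> U Y V; U \<in> \<H>\<rbrakk> \<Longrightarrow> Y \<in> \<H>"
begin

text \<open>\<open>ET4op\<close> on \<open>K\<close> -> \<open>W\<close> -> \<open>U\<close> and
  \<open>M\<close> -> \<open>U\<close> -> \<open>V\<close> yields an object \<open>E\<close> with
  \<open>K\<close> -> \<open>E\<close> -> \<open>M\<close> and \<open>E\<close> -> \<open>W\<close>
  -> \<open>V\<close>; the latter puts \<open>E\<close> into
  \<open>check \<C> \<omega>\<close>.\<close>

lemma cocone_form_to_cone_form:
  assumes "has_etriangle \<C> M U V" "U \<in> \<H>" "V \<in> check \<C> \<omega>"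
  shows "\<exists>U' V'. has_etriangle \<C> U' V' M \<and> U' \<in> \<H> \<and> V' \<in> check \<C> \<omega>"
proof -
  obtain K W where K: "K \<in> \<H>" "W \<in> \<omega>" "has_etriangle \<C> K W U" using cover[OF assms(2)] by blast
  then show ?thesis using has_etriangle_ET4op[OF K(3) assms(1)] check_step assms(3) by blast
qed

text \<open>Dually, \<open>ET4\<close> yields \<open>E\<close> with \<open>U\<close> ->
  \<open>W\<close> -> \<open>E\<close> and \<open>M\<close> -> \<open>E\<close> -> \<open>K\<close>;
  the former puts \<open>E\<close> into \<open>\<H>\<close> by \<open>cone\<close>.\<close>

lemma cone_form_to_cocone_form:
  assumes "has_etriangle \<C> U V M" "U \<in> \<H>" "V \<in> check \<C> \<omega>"
  shows "\<exists>U' V'. has_etriangle \<C> M U' V' \<and> U' \<in> \<H> \<and> V' \<in> check \<C> \<omega>"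
proof -
  obtain K W where K: "K \<in> check \<C> \<omega>" "W \<in> \<omega>" "has_etriangle \<C> V W K"
    using check_omega_embedding[OF assms(3)] by blast
  then show ?thesis using has_etriangle_ET4[OF assms(1) K(3)] cone assms(2) by blast
qed

lemma check_to_cocone_form:
  assumes "M \<in> check \<C> \<H>"
  shows "\<exists>U V. has_etriangle \<C> M U V \<and> U \<in> \<H> \<and> V \<in> check \<C> \<omega>"
  using assms
proof (induction rule: check_induct)
  case (base M)
  obtain Z where "is_zero_object \<C> Z" "Z \<in> \<omega>" by (rule zero_object_in_omega)
  then show ?case using base has_etriangle_zero_right check_base omega_Ob by meson
next
  case (step K H M)
  \<comment> \<open>The induction hypothesis embeds \<open>K\<close>, whereas the pullback needs
    \<open>K\<close> as a common cone, hence the change of form.\<close>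
  then obtain U V where UV: "has_etriangle \<C> U V K" "U \<in> \<H>" "V \<in> check \<C> \<omega>"
    using cocone_form_to_cone_form by blast
  obtain Y where "has_etriangle \<C> M Y V" "has_etriangle \<C> U Y H"
    using has_etriangle_pullback[OF step.hyps(1) UV(1)] by blast
  then show ?case using extension step.hyps(3) UV by blast
qed

lemma cocone_form_to_check:
  "\<lbrakk>has_etriangle \<C> M U V; U \<in> \<H>; V \<in> check \<C> \<omega>\<rbrakk> \<Longrightarrow> M \<in> check \<C> \<H>"
  using check_step check_mono[OF omega_subset] by blast

lemma check_iff:
  "M \<in> check \<C> \<H> \<longleftrightarrow> (\<exists>U x V y. etriangle \<C> U x V y M \<and> U \<in> \<H> \<and> V \<in> check \<C> \<omega>)" (is ?cone)
  "M \<in> check \<C> \<H> \<longleftrightarrow> (\<exists>x U y V. etriangle \<C> M x U y V \<and> U \<in> \<H> \<and> V \<in> check \<C> \<omega>)" (is ?cocone)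
proof -
  have "M \<in> check \<C> \<H> \<longleftrightarrow> (\<exists>U V. has_etriangle \<C> M U V \<and> U \<in> \<H> \<and> V \<in> check \<C> \<omega>)"
    using check_to_cocone_form cocone_form_to_check by blast
  moreover have "(\<exists>U V. has_etriangle \<C> M U V \<and> U \<in> \<H> \<and> V \<in> check \<C> \<omega>) \<longleftrightarrow>
      (\<exists>U V. has_etriangle \<C> U V M \<and> U \<in> \<H> \<and> V \<in> check \<C> \<omega>)"
    using cocone_form_to_cone_form cone_form_to_cocone_form by blast
  ultimately show ?cone ?cocone unfolding has_etriangle_def by blast+
qed

end

theorem proposition3p3:
  fixes \<C> :: "('o, 'm, 'e, 'z) extcat_scheme" and \<omega> :: "'o set" and M :: 'o
  assumes "extriangulated_category \<C>"
    and "krull_schmidt \<C>"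
    and "enough_projectives \<C>"
    and "enough_injectives \<C>"
    and "subcategory \<C> \<omega>"
    and "self_orthogonal \<C> \<omega>"
    and "M \<in> Ob\<^bsub>\<C>\<^esub>"
  shows "(M \<in> tilde \<C> \<omega> \<longleftrightarrow>
            (\<exists>U x V y. etriangle \<C> U x V y M \<and> U \<in> hat \<C> \<omega> \<and> V \<in> check \<C> \<omega>)) \<and>
         (M \<in> tilde \<C> \<omega> \<longleftrightarrow>
            (\<exists>x U' y V'. etriangle \<C> M x U' y V' \<and> U' \<in> hat \<C> \<omega> \<and> V' \<in> check \<C> \<omega>)) \<and>
         (M \<in> check \<C> (X_class \<C> \<omega>) \<longleftrightarrow>
            (\<exists>U x V y. etriangle \<C> U x V y M \<and> U \<in> X_class \<C> \<omega> \<and> V \<in> check \<C> \<omega>)) \<and>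
         (M \<in> check \<C> (X_class \<C> \<omega>) \<longleftrightarrow>
            (\<exists>x U' y V'. etriangle \<C> M x U' y V' \<and> U' \<in> X_class \<C> \<omega> \<and> V' \<in> check \<C> \<omega>))"
proof -
  interpret extriangulated_category \<C> by fact
  interpret self_orthogonal_subcategory \<C> \<omega> by unfold_locales fact+
  interpret hat: omega_covered_class \<C> \<omega> "hat \<C> \<omega>"
  proof unfold_locales
    show "\<omega> \<subseteq> hat \<C> \<omega>" using hat_base omega_Ob by blast
  qed (fact hat_cover hat_step hat_extension)+
  interpret X: omega_covered_class \<C> \<omega> "X_class \<C> \<omega>"
  proof unfold_locales
    show "\<omega> \<subseteq> X_class \<C> \<omega>" using omega_X_class by blast
  qed (fact X_class_cover X_class_step X_class_extension)+
  show ?thesis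
    unfolding tilde_def using hat.check_iff[of M] X.check_iff[of M] by (intro conjI)
qed

end
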